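(* Let $|\psi\rangle=\sum_j\sqrt{p_j}|j,j\rangle_{\hat n}$ and $|\phi\rangle=\sum_j\sqrt{q_j}|j,j\rangle_{\hat n}$ be states in $\mathcal{H}_{\hat n}$, and suppose there is exactly one $J\in\{0,\tfrac12,1,\dots\}$ with $\mathrm{j\text{-}Spec}(\phi)\subseteq\mathrm{j\text{-}Spec}(\psi)-J$. Then the maximum probability of achieving $|\psi\rangle\to|\phi\rangle$ using SU(2)-invariant operations is $$P(|\psi\rangle\to|\phi\rangle)=\min_{j:\,q_{j-J}>0}\frac{p_j}{q_{j-J}}.$$
   Context: $\mathcal{H}'=\bigoplus_{j\in\{0,1/2,1,\dots\}}\mathcal{M}_j$ with $\mathcal{M}_j$ carrying the spin-$j$ irreducible representation of SU(2), acting by $T(\vec\theta)=\exp(i\vec\theta\cdot\hat{\mathbf J})$. For a unit vector $\hat n$, $|j,j\rangle_{\hat n}\in\mathcal{M}_j$ is the eigenvector of $\hat n\cdot\hat{\mathbf J}$ with eigenvalue $j$; $\mathcal{H}_{\hat n}=\mathrm{span}\{|j,j\rangle_{\hat n}\}$. $\mathrm{j\text{-}Spec}(\psi)=\{j:p_j\ne0\}$, $\mathrm{j\text{-}Spec}(\phi)=\{j:q_j\neq0\}$, $\mathrm{j\text{-}Spec}(\psi)-J=\{j-J:p_j\neq0\}$. An SU(2)-invariant operation is a completely positive, trace-nonincreasing linear map $\mathcal{E}$ on operators on $\mathcal{H}'$ with $\mathcal{E}(T(g)XT(g)^\dagger)=T(g)\mathcal{E}(X)T(g)^\dagger$ for all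 $g,X$. The probability of achieving $|\psi\rangle\to|\phi\rangle$ is the largest $\lambda$ such that some SU(2)-invariant operation satisfies $\mathcal{E}(|\psi\rangle\langle\psi|)=\lambda|\phi\rangle\langle\phi|$. *)

theory Defs
  imports "HOL-Analysis.Analysis"
begin

text \<open>Hilbert space H' = direct sum of spin-j irreps M_j, j = d/2 (d :: nat).
  Orthonormal basis vector (d,k) with k \<le> d is |j,m> (z-axis basis) with j = d/2, m = j - k.
  Vectors and operators are given by coordinates / matrix entries in this basis.\<close>

type_synonym bas = "nat \<times> nat"
type_synonym vec = "bas \<Rightarrow> complex"
type_synonym opr = "bas \<Rightarrow> bas \<Rightarrow> complex"

definition valid :: "bas \<Rightarrow> bool" where
  "valid x \<longleftrightarrow> snd x \<le> fst x"

definition l2vec :: "vec \<Rightarrow> bool" where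
  "l2vec v \<longleftrightarrow> (\<forall>x. \<not> valid x \<longrightarrow> v x = 0) \<and> (\<lambda>x. (cmod (v x))^2) summable_on UNIV"

text \<open>Finite-rank operators on H' (dense in the trace class).\<close>
definition finite_rank_op :: "opr \<Rightarrow> bool" where
  "finite_rank_op X \<longleftrightarrow> (\<exists>(N::nat) u w. (\<forall>i<N. l2vec (u i) \<and> l2vec (w i)) \<and>
      X = (\<lambda>x y. \<Sum>i<N. u i x * cnj (w i y)))"

definition cnonneg :: "complex \<Rightarrow> bool" where
  "cnonneg z \<longleftrightarrow> Im z = 0 \<and> 0 \<le> Re z"

definition psd_op :: "opr \<Rightarrow> bool" where
  "psd_op X \<longleftrightarrow> (\<forall>F w. finite F \<longrightarrow>
      cnonneg (\<Sum>x\<in>F. \<Sum>y\<in>F. cnj (w x) * X x y * w y))"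

definition psd_block :: "nat \<Rightarrow> (nat \<Rightarrow> nat \<Rightarrow> opr) \<Rightarrow> bool" where
  "psd_block n M \<longleftrightarrow> (\<forall>F w. finite F \<longrightarrow>
      cnonneg (\<Sum>a<n. \<Sum>b<n. \<Sum>x\<in>F. \<Sum>y\<in>F. cnj (w a x) * M a b x y * w b y))"

definition trace_op :: "opr \<Rightarrow> complex" where
  "trace_op X = infsum (\<lambda>x. X x x) UNIV"

text \<open>Spin-j angular momentum matrices on the block d (indices k,l \<le> d, m = d/2 - k).\<close>
definition Jz :: "nat \<Rightarrow> nat \<Rightarrow> nat \<Rightarrow> complex" where
  "Jz d k l = (if k = l then complex_of_real (real d / 2 - real k) else 0)"

definition Jp :: "nat \<Rightarrow> nat \<Rightarrow> nat \<Rightarrow> complex" where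
  "Jp d k l = (if k + 1 = l then complex_of_real (sqrt (real l * (real d - real l + 1))) else 0)"

definition Jm :: "nat \<Rightarrow> nat \<Rightarrow> nat \<Rightarrow> complex" where
  "Jm d k l = cnj (Jp d l k)"

definition Jx :: "nat \<Rightarrow> nat \<Rightarrow> nat \<Rightarrow> complex" where
  "Jx d k l = (Jp d k l + Jm d k l) / 2"

definition Jy :: "nat \<Rightarrow> nat \<Rightarrow> nat \<Rightarrow> complex" where
  "Jy d k l = (Jp d k l - Jm d k l) / (2 * \<i>)"

definition nJ :: "real \<Rightarrow> real \<Rightarrow> real \<Rightarrow> nat \<Rightarrow> nat \<Rightarrow> nat \<Rightarrow> complex" where
  "nJ a b c d k l = of_real a * Jx d k l + of_real b * Jy d k l + of_real c * Jz d k l"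

fun mpow :: "nat \<Rightarrow> (nat \<Rightarrow> nat \<Rightarrow> complex) \<Rightarrow> nat \<Rightarrow> nat \<Rightarrow> nat \<Rightarrow> complex" where
  "mpow d A 0 k l = (if k = l then 1 else 0)"
| "mpow d A (Suc n) k l = (\<Sum>r\<le>d. A k r * mpow d A n r l)"

definition mexp :: "nat \<Rightarrow> (nat \<Rightarrow> nat \<Rightarrow> complex) \<Rightarrow> nat \<Rightarrow> nat \<Rightarrow> complex" where
  "mexp d A k l = (\<Sum>n. mpow d A n k l / of_nat (fact n))"

definition Trep :: "real \<Rightarrow> real \<Rightarrow> real \<Rightarrow> opr" where
  "Trep t1 t2 t3 = (\<lambda>x y. if fst x = fst y \<and> valid x \<and> valid y
      then mexp (fst x) (\<lambda>k l. \<i> * nJ t1 t2 t3 (fst x) k l) (snd x) (snd y) else 0)"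

text \<open>U X U^dagger for block-diagonal U.\<close>
definition conj_op :: "opr \<Rightarrow> opr \<Rightarrow> opr" where
  "conj_op U X = (\<lambda>x y. \<Sum>a\<le>fst x. \<Sum>b\<le>fst y.
      U x (fst x, a) * X (fst x, a) (fst y, b) * cnj (U y (fst y, b)))"

text \<open>SU(2)-invariant operation: linear, completely positive, trace-nonincreasing,
  covariant map on (finite-rank, hence by continuity trace-class) operators on H'.\<close>
definition su2_invariant_operation :: "(opr \<Rightarrow> opr) \<Rightarrow> bool" where
  "su2_invariant_operation E \<longleftrightarrow>
     (\<forall>X. finite_rank_op X \<longrightarrow> (\<forall>x y. \<not> valid x \<or> \<not> valid y \<longrightarrow> E X x y = 0)) \<and>
     (\<forall>X Y. finite_rank_op X \<longrightarrow> finite_rank_op Y \<longrightarrow>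
        E (\<lambda>x y. X x y + Y x y) = (\<lambda>x y. E X x y + E Y x y)) \<and>
     (\<forall>c X. finite_rank_op X \<longrightarrow> E (\<lambda>x y. c * X x y) = (\<lambda>x y. c * E X x y)) \<and>
     (\<forall>n M. (\<forall>a<n. \<forall>b<n. finite_rank_op (M a b)) \<longrightarrow> psd_block n M \<longrightarrow>
        psd_block n (\<lambda>a b. E (M a b))) \<and>
     (\<forall>X. finite_rank_op X \<longrightarrow> psd_op X \<longrightarrow>
        (\<forall>F. finite F \<longrightarrow> (\<Sum>x\<in>F. Re (E X x x)) \<le> Re (trace_op X))) \<and>
     (\<forall>t1 t2 t3 X. finite_rank_op X \<longrightarrow>
        E (conj_op (Trep t1 t2 t3) X) = conj_op (Trep t1 t2 t3) (E X))"

definition outer :: "vec \<Rightarrow> vec \<Rightarrow> opr" where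
  "outer u v = (\<lambda>x y. u x * cnj (v y))"

definition achievable :: "vec \<Rightarrow> vec \<Rightarrow> real \<Rightarrow> bool" where
  "achievable \<psi> \<phi> lam \<longleftrightarrow> (\<exists>E. su2_invariant_operation E \<and>
      E (outer \<psi> \<psi>) = (\<lambda>x y. complex_of_real lam * outer \<phi> \<phi> x y))"

definition is_max_prob :: "vec \<Rightarrow> vec \<Rightarrow> real \<Rightarrow> bool" where
  "is_max_prob \<psi> \<phi> P \<longleftrightarrow> achievable \<psi> \<phi> P \<and> (\<forall>lam. achievable \<psi> \<phi> lam \<longrightarrow> lam \<le> P)"

definition halfints :: "real set" where
  "halfints = {real d / 2 | d. True}"

definition coef :: "(nat \<Rightarrow> real) \<Rightarrow> real \<Rightarrow> real" where
  "coef p j = p (nat (round (2 * j)))"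

definition jSpec :: "(nat \<Rightarrow> real) \<Rightarrow> real set" where
  "jSpec p = {j \<in> halfints. coef p j \<noteq> 0}"

text \<open>State sum_j sqrt(p_j) |j,j>_n, with e d the chosen vector |j,j>_n in block d.\<close>
definition hstate :: "(nat \<Rightarrow> nat \<Rightarrow> complex) \<Rightarrow> (nat \<Rightarrow> real) \<Rightarrow> vec" where
  "hstate e p = (\<lambda>x. if valid x then complex_of_real (sqrt (p (fst x))) * e (fst x) (snd x) else 0)"

end

theory Submission
  imports Defs
begin

text \<open>
Achievability: spin \<open>j + J\<close> sits in spin \<open>j\<close> tensor spin \<open>J\<close> as the stretched component, and there the
highest weight vector along any axis is the product of the highest weight vectors. Embedding each
block, weighting it by \<open>sqrt (lam * q j / p (j + J))\<close> (up to a phase) and tracing out the spin \<open>J\<close> factor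
is therefore an invariant operation with output \<open>lam\<close> times the target; it does not increase the
trace when all weights are at most 1.

Upper bound: instead of a Kraus decomposition, use the positive semidefinite form
\<open><v|E(|x><y|)|w>\<close>. Covariance under rotations about the axis makes it graded by the weight shift, so
\<open>lam * q a\<close> is the sum over \<open>d\<close> of \<open>p d\<close> times the transition weight from \<open>d\<close> to \<open>a\<close>, each at most 1.
Since the output is pure, a shift \<open>d - a \<ge> 0\<close> contributes only if it carries the whole spectrum of
the target into that of the input, which leaves \<open>d = a + 2 J\<close> (blocks are indexed by twice the spin);
shifts that raise the spin are excluded because operators on a smaller spin cannot carry the
coherences of a coherent state of a larger one.
\<close>

section \<open>Matrix exponentials\<close>

text \<open>The input may be an infinite superposition, while \<open>E\<close> is only known to be
  linear on finite-rank operators. Expanding \<open>E\<close> over blocks therefore needs a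
  continuity argument: positivity gives a Cauchy-Schwarz inequality, and the trace bound then makes
  the contribution of the tails tend to zero. The uniqueness hypothesis speaks of nonnegative shifts
  only; a negative shift may well carry the spectrum of the target into that of the input. This is
  why raising has to be excluded by representation theory and not by comparing spectra. The formulas
  come from symmetric states of spins 1/2. A basis vector of spin d/2 is a normalised symmetric
  state of d such spins, and a highest weight vector along an axis is, up to a phase, the d-fold
  tensor power of one spinor (\<alpha>, \<beta>); square roots of binomial coefficients are the
  resulting normalisations. Splitting d + D spins into d and D yields both the invariant embedding
  and the factorisation of coherent states.\<close>

lemma mpow_bound:
  assumes "\<And>i j. i \<le> d \<Longrightarrow> j \<le> d \<Longrightarrow> cmod (A i j) \<le> C" "0 \<le> C" "k \<le> d" "l \<le> d"
  shows "cmod (mpow d A n k l) \<le> (real (Suc d) * C) ^ n"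
  using assms(3)
proof (induction n arbitrary: k)
  case (Suc n)
  have "cmod (mpow d A (Suc n) k l) \<le> (\<Sum>r\<le>d. cmod (A k r) * cmod (mpow d A n r l))"
    by (auto intro: order_trans[OF norm_sum] simp: norm_mult)
  also have "\<dots> \<le> (\<Sum>r\<le>d. C * (real (Suc d) * C) ^ n)"
    using Suc assms(1,2) by (intro sum_mono mult_mono) auto
  finally show ?case by (simp add: mult.assoc)
qed simp

lemma mpow_summable:
  assumes "k \<le> d" "l \<le> d"
  shows "summable (\<lambda>n. cmod (mpow d A n k l / of_nat (fact n)))"
proof -
  define C where "C = (\<Sum>i\<le>d. \<Sum>j\<le>d. cmod (A i j))"
  have C: "cmod (A i j) \<le> C" if "i \<le> d" "j \<le> d" for i j
  proof -
    have "cmod (A i j) \<le> (\<Sum>j\<le>d. cmod (A i j))"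
      using that by (intro member_le_sum) auto
    also have "\<dots> \<le> C" unfolding C_def
      using that by (intro member_le_sum[where f="\<lambda>i. \<Sum>j\<le>d. cmod (A i j)"]) (auto intro: sum_nonneg)
    finally show ?thesis .
  qed
  have "0 \<le> C" by (simp add: C_def sum_nonneg)
  have "cmod (mpow d A n k l / of_nat (fact n)) \<le> inverse (fact n) * (real (Suc d) * C) ^ n" for n
  proof -
    have "cmod (mpow d A n k l / of_nat (fact n)) = cmod (mpow d A n k l) / fact n"
      by (simp add: norm_divide)
    also have "\<dots> \<le> (real (Suc d) * C) ^ n / fact n"
      by (rule divide_right_mono, rule mpow_bound) (use C \<open>0 \<le> C\<close> assms in auto)
    finally show ?thesis by (simp only: divide_inverse mult.commute[of "inverse (fact n)"])
  qed
  then show ?thesis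
    by (intro summable_comparison_test'[OF summable_exp[of "real (Suc d) * C"], of 0]) (simp only: real_norm_def abs_norm_cancel)
qed

lemma mexp_sums:
  assumes "k \<le> d" "l \<le> d"
  shows "(\<lambda>n. mpow d A n k l / of_nat (fact n)) sums mexp d A k l"
  unfolding mexp_def by (rule summable_sums[OF summable_norm_cancel[OF mpow_summable[OF assms]]])

lemma mexp_eigen:
  assumes "\<And>i. i \<le> d \<Longrightarrow> (\<Sum>l\<le>d. A i l * v l) = \<mu> * v i" "k \<le> d"
  shows "(\<Sum>l\<le>d. mexp d A k l * v l) = exp \<mu> * v k"
proof -
  have pow: "(\<Sum>l\<le>d. mpow d A n k l * v l) = \<mu> ^ n * v k" if "k \<le> d" for n k
    using that
  proof (induction n arbitrary: k)
    case 0
    have "(\<Sum>l\<le>d. mpow d A 0 k l * v l) = (\<Sum>l\<le>d. if k = l then v l else 0)"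
      by (intro sum.cong) auto
    then show ?case using 0 by simp
  next
    case (Suc n)
    have "(\<Sum>l\<le>d. mpow d A (Suc n) k l * v l) = (\<Sum>r\<le>d. A k r * (\<Sum>l\<le>d. mpow d A n r l * v l))"
      unfolding mpow.simps sum_distrib_left sum_distrib_right mult.assoc by (rule sum.swap)
    also have "\<dots> = (\<Sum>r\<le>d. \<mu> ^ n * (A k r * v r))"
      using Suc.IH by (intro sum.cong) auto
    also have "\<dots> = \<mu> ^ n * (\<mu> * v k)"
      unfolding sum_distrib_left[symmetric] assms(1)[OF Suc.prems] ..
    finally show ?case by simp
  qed
  have "(\<lambda>n. \<Sum>l\<le>d. mpow d A n k l / of_nat (fact n) * v l) sums (\<Sum>l\<le>d. mexp d A k l * v l)"
    using mexp_sums[OF assms(2)] by (intro sums_sum sums_mult2) auto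
  also have "(\<lambda>n. \<Sum>l\<le>d. mpow d A n k l / of_nat (fact n) * v l) = (\<lambda>n. (\<mu> ^ n /\<^sub>R fact n) * v k)"
  proof
    fix n
    have "(\<Sum>l\<le>d. mpow d A n k l / of_nat (fact n) * v l) = (\<Sum>l\<le>d. mpow d A n k l * v l) / of_nat (fact n)"
      by (simp only: sum_divide_distrib times_divide_eq_left)
    then show "(\<Sum>l\<le>d. mpow d A n k l / of_nat (fact n) * v l) = (\<mu> ^ n /\<^sub>R fact n) * v k"
      unfolding pow[OF assms(2)] by (simp add: scaleR_conv_of_real divide_inverse mult_ac)
  qed
  finally show ?thesis
    using sums_mult2[OF exp_converges[of \<mu>], of "v k"] by (rule sums_unique2)
qed

lemma mpow_Suc_right:
  assumes "k \<le> d" "l \<le> d"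
  shows "mpow d A (Suc n) k l = (\<Sum>r\<le>d. mpow d A n k r * A r l)"
  using assms(1)
proof (induction n arbitrary: k)
  case 0
  have "(\<Sum>r\<le>d. A k r * (if r = l then 1 else 0)) = (\<Sum>r\<le>d. if r = l then A k r else 0)"
    "(\<Sum>r\<le>d. (if k = r then 1 else 0) * A r l) = (\<Sum>r\<le>d. if k = r then A r l else 0)"
    by (intro sum.cong; simp)+
  then show ?case using 0 assms(2) by simp
next
  case (Suc n)
  have "mpow d A (Suc (Suc n)) k l = (\<Sum>s\<le>d. A k s * (\<Sum>r\<le>d. mpow d A n s r * A r l))"
    unfolding mpow.simps(2)[of d A "Suc n"] using Suc by (intro sum.cong) auto
  also have "\<dots> = (\<Sum>r\<le>d. \<Sum>s\<le>d. A k s * (mpow d A n s r * A r l))"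
    unfolding sum_distrib_left by (rule sum.swap)
  finally show ?case by (simp add: sum_distrib_right mult.assoc)
qed

text \<open>For an antihermitian generator the adjoint of the exponential is the exponential of the
  negative; with \<open>mexp_minus_mult\<close> this yields unitarity. Taking adjoints reverses
  products, hence the recursion from the right.\<close>

lemma mexp_adjoint:
  assumes "\<And>i j. i \<le> d \<Longrightarrow> j \<le> d \<Longrightarrow> cnj (A j i) = - A i j" "k \<le> d" "l \<le> d"
  shows "cnj (mexp d A l k) = mexp d (\<lambda>i j. - A i j) k l"
proof -
  have pow: "cnj (mpow d A n l k) = mpow d (\<lambda>i j. - A i j) n k l" if "l \<le> d" for n l
    using that
  proof (induction n arbitrary: l)
    case (Suc n)
    have "cnj (mpow d A (Suc n) l k) = (\<Sum>r\<le>d. cnj (A l r) * cnj (mpow d A n r k))" by simp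
    also have "\<dots> = (\<Sum>r\<le>d. mpow d (\<lambda>i j. - A i j) n k r * - A r l)"
      using Suc assms(1) by (intro sum.cong) auto
    also have "\<dots> = mpow d (\<lambda>i j. - A i j) (Suc n) k l"
      using mpow_Suc_right[OF assms(2) Suc.prems, of "\<lambda>i j. - A i j" n] by simp
    finally show ?case .
  qed auto
  have "(\<lambda>n. cnj (mpow d A n l k / of_nat (fact n))) sums cnj (mexp d A l k)"
    using mexp_sums[OF assms(3,2)] by (simp only: sums_cnj)
  then have "(\<lambda>n. mpow d (\<lambda>i j. - A i j) n k l / of_nat (fact n)) sums cnj (mexp d A l k)"
    by (simp add: pow[OF assms(3)])
  then show ?thesis using mexp_sums[OF assms(2,3)] by (rule sums_unique2)
qed

lemma fact_Suc_cancel: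
  fixes x :: complex
  shows "of_nat (Suc n) * (x / of_nat (fact (Suc n))) = x / of_nat (fact n)"
  by (simp only: fact_Suc of_nat_mult) (simp del: of_nat_Suc)

lemma mpow_fact_Suc:
  "of_nat (Suc n) * (mpow d A (Suc n) k l / of_nat (fact (Suc n)))
     = (\<Sum>r\<le>d. A k r * (mpow d A n r l / of_nat (fact n)))"
  unfolding fact_Suc_cancel by (simp only: mpow.simps sum_divide_distrib times_divide_eq_right)

lemma mpow_fact_Suc_right:
  assumes "k \<le> d" "l \<le> d"
  shows "of_nat (Suc n) * (mpow d A (Suc n) k l / of_nat (fact (Suc n)))
     = (\<Sum>r\<le>d. (mpow d A n k r / of_nat (fact n)) * A r l)"
  unfolding fact_Suc_cancel by (simp only: mpow_Suc_right[OF assms] sum_divide_distrib times_divide_eq_left)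

text \<open>Differentiating a product of exponential series: the factor \<open>n + 1\<close> splits
  as \<open>r + (n + 1 - r)\<close> over the terms of the Cauchy product.\<close>

lemma cauchy_coeff_Suc:
  fixes a b :: "nat \<Rightarrow> complex"
  shows "of_nat (Suc n) * (\<Sum>r\<le>Suc n. a r * b (Suc n - r))
    = (\<Sum>r\<le>n. (of_nat (Suc r) * a (Suc r)) * b (n - r))
      + (\<Sum>r\<le>n. a r * (of_nat (Suc (n - r)) * b (Suc (n - r))))"
proof -
  have "of_nat (Suc n) * (\<Sum>r\<le>Suc n. a r * b (Suc n - r))
      = (\<Sum>r\<le>Suc n. (of_nat r * a r) * b (Suc n - r)) + (\<Sum>r\<le>Suc n. a r * (of_nat (Suc n - r) * b (Suc n - r)))"
    unfolding sum_distrib_left sum.distrib[symmetric]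
    by (intro sum.cong refl) (auto simp: of_nat_diff algebra_simps)
  also have "(\<Sum>r\<le>Suc n. (of_nat r * a r) * b (Suc n - r)) = (\<Sum>r\<le>n. (of_nat (Suc r) * a (Suc r)) * b (n - r))"
    by (subst sum.atMost_Suc_shift) simp
  also have "(\<Sum>r\<le>Suc n. a r * (of_nat (Suc n - r) * b (Suc n - r)))
      = (\<Sum>r\<le>n. a r * (of_nat (Suc (n - r)) * b (Suc (n - r))))"
    unfolding sum.atMost_Suc by (simp add: Suc_diff_le del: of_nat_Suc)
  finally show ?thesis .
qed

text \<open>Coefficient form of the fact that exp(tA) exp(-tA) has derivative 0: the new factor of
  \<open>A\<close> is taken from the right end of the left power and from the left end of the right
  power, where it carries opposite signs.\<close>

lemma mexp_minus_mult:
  assumes "k \<le> d" "l \<le> d"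
  shows "(\<Sum>m\<le>d. mexp d A k m * mexp d (\<lambda>i j. - A i j) m l) = (if k = l then 1 else 0)"
proof -
  define B where "B = (\<lambda>i j. - A i j)"
  define a where "a = (\<lambda>k m n. mpow d A n k m / of_nat (fact n))"
  define b where "b = (\<lambda>m l n. mpow d B n m l / of_nat (fact n))"
  define c where "c = (\<lambda>n. \<Sum>m\<le>d. \<Sum>r\<le>n. a k m r * b m l (n - r))"
  have "(\<lambda>n. \<Sum>r\<le>n. a k m r * b m l (n - r)) sums (mexp d A k m * mexp d B m l)" if "m \<le> d" for m
    unfolding a_def b_def mexp_def
    using Cauchy_product_sums[OF mpow_summable[of k d m A] mpow_summable[of m d l B]] assms that
    by simp
  then have s: "c sums (\<Sum>m\<le>d. mexp d A k m * mexp d B m l)"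
    unfolding c_def by (intro sums_sum) auto
  have "of_nat (Suc n) * c (Suc n) = 0" for n
  proof -
    have "of_nat (Suc n) * c (Suc n) = (\<Sum>m\<le>d. of_nat (Suc n) * (\<Sum>r\<le>Suc n. a k m r * b m l (Suc n - r)))"
      unfolding c_def sum_distrib_left ..
    also have "\<dots> = (\<Sum>m\<le>d. \<Sum>r\<le>n. (of_nat (Suc r) * a k m (Suc r)) * b m l (n - r))
      + (\<Sum>m\<le>d. \<Sum>r\<le>n. a k m r * (of_nat (Suc (n - r)) * b m l (Suc (n - r))))"
      unfolding cauchy_coeff_Suc sum.distrib ..
    also have "(\<Sum>m\<le>d. \<Sum>r\<le>n. (of_nat (Suc r) * a k m (Suc r)) * b m l (n - r))
        = (\<Sum>m\<le>d. \<Sum>r\<le>n. (\<Sum>s\<le>d. a k s r * A s m) * b m l (n - r))"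
      unfolding a_def using assms by (intro sum.cong refl) (simp only: mpow_fact_Suc_right atMost_iff)
    also have "\<dots> = (\<Sum>r\<le>n. \<Sum>m\<le>d. \<Sum>s\<le>d. a k s r * A s m * b m l (n - r))"
      unfolding sum_distrib_right by (rule sum.swap)
    also have "(\<Sum>m\<le>d. \<Sum>r\<le>n. a k m r * (of_nat (Suc (n - r)) * b m l (Suc (n - r))))
        = (\<Sum>m\<le>d. \<Sum>r\<le>n. a k m r * (\<Sum>s\<le>d. B m s * b s l (n - r)))"
      unfolding b_def by (simp only: mpow_fact_Suc)
    also have "\<dots> = (\<Sum>r\<le>n. \<Sum>m\<le>d. \<Sum>s\<le>d. a k m r * (B m s * b s l (n - r)))"
      unfolding sum_distrib_left by (rule sum.swap)
    also have "\<dots> = (\<Sum>r\<le>n. \<Sum>m\<le>d. \<Sum>s\<le>d. a k s r * (B s m * b m l (n - r)))"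
      by (rule sum.cong[OF refl], rule sum.swap)
    finally show ?thesis
      by (simp add: B_def sum_negf mult.assoc)
  qed
  then have "c n = 0" if "n \<noteq> 0" for n
    using that by (cases n) (auto simp del: of_nat_Suc)
  moreover have "c 0 = (if k = l then 1 else 0)"
  proof -
    have "c 0 = (\<Sum>m\<le>d. if m = k then (if k = l then 1 else 0) else 0)"
      unfolding c_def a_def b_def by (intro sum.cong) auto
    then show ?thesis using assms by simp
  qed
  ultimately have "c = (\<lambda>n. if n = 0 then (if k = l then 1 else 0) else 0)"
    by (intro ext) simp
  then have "c sums (if k = l then 1 else 0)"
    using sums_single[of 0 "\<lambda>_. if k = l then 1 else (0::complex)"] by simp
  with s show ?thesis unfolding B_def by (rule sums_unique2)
qed

text \<open>\<open>W\<close> defines a map sending \<open>g\<close> on \<open>{..d + D}\<close> to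
  the function \<open>W i l * g (i + l)\<close> of two indices. If it intertwines \<open>A\<close>
  with the sum of \<open>A1\<close> and \<open>A2\<close> acting on the separate indices, it
  intertwines the exponentials, as these two actions commute.\<close>

lemma mexp_intertwine:
  assumes step: "\<And>k b g. k \<le> d \<Longrightarrow> b \<le> D \<Longrightarrow>
      W k b * (\<Sum>r\<le>d + D. A (k + b) r * g r)
        = (\<Sum>i\<le>d. A1 k i * (W i b * g (i + b))) + (\<Sum>l\<le>D. A2 b l * (W k l * g (k + l)))"
    and "k \<le> d" "b \<le> D"
  shows "W k b * (\<Sum>r\<le>d + D. mexp (d + D) A (k + b) r * g r)
    = (\<Sum>i\<le>d. \<Sum>l\<le>D. mexp d A1 k i * mexp D A2 b l * (W i l * g (i + l)))"
proof -
  define a where "a = (\<lambda>k i n. mpow d A1 n k i / of_nat (fact n))"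
  define h where "h = (\<lambda>b l n. mpow D A2 n b l / of_nat (fact n))"
  define f where "f = (\<lambda>m r n. mpow (d + D) A n m r / of_nat (fact n))"
  define F where "F = (\<lambda>n k b. W k b * (\<Sum>r\<le>d + D. f (k + b) r n * g r))"
  define G where "G = (\<lambda>n k b. \<Sum>i\<le>d. \<Sum>l\<le>D. (\<Sum>r\<le>n. a k i r * h b l (n - r)) * (W i l * g (i + l)))"
  \<comment> \<open>Both sequences of Taylor coefficients obey the same recursion, the coefficient
    form of one differential equation, and agree at 0.\<close>
  have FG: "F n k b = G n k b" if "k \<le> d" "b \<le> D" for n k b
    using that
  proof (induction n arbitrary: k b)
    case 0
    have "F 0 k b = W k b * (\<Sum>r\<le>d + D. if r = k + b then g r else 0)"
      unfolding F_def f_def by (intro arg_cong2[where f="(*)"] sum.cong) auto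
    also have "\<dots> = W k b * g (k + b)" using 0 by simp
    also have "\<dots> = (\<Sum>i\<le>d. if i = k then W k b * g (k + b) else 0)" using 0 by simp
    also have "\<dots> = (\<Sum>i\<le>d. \<Sum>l\<le>D. if l = b then (if i = k then W i l * g (i + l) else 0) else 0)"
      using 0 by (intro sum.cong) auto
    also have "\<dots> = G 0 k b"
      unfolding G_def a_def h_def by (intro sum.cong) auto
    finally show ?case .
  next
    case (Suc n)
    have "of_nat (Suc n) * F (Suc n) k b = W k b * (\<Sum>r\<le>d + D. (of_nat (Suc n) * f (k + b) r (Suc n)) * g r)"
      unfolding F_def sum_distrib_left by (simp add: mult_ac)
    also have "\<dots> = W k b * (\<Sum>r\<le>d + D. \<Sum>s\<le>d + D. A (k + b) s * (f s r n * g r))"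
      unfolding f_def mpow_fact_Suc sum_distrib_right by (simp add: mult_ac)
    also have "\<dots> = W k b * (\<Sum>s\<le>d + D. A (k + b) s * (\<Sum>r\<le>d + D. f s r n * g r))"
      unfolding sum_distrib_left by (subst sum.swap) simp
    also have "\<dots> = (\<Sum>i\<le>d. A1 k i * F n i b) + (\<Sum>l\<le>D. A2 b l * F n k l)"
      unfolding F_def by (rule step[OF Suc.prems])
    also have "\<dots> = (\<Sum>i\<le>d. A1 k i * G n i b) + (\<Sum>l\<le>D. A2 b l * G n k l)"
      using Suc by (intro arg_cong2[where f="(+)"] sum.cong) auto
    also have "(\<Sum>i\<le>d. A1 k i * G n i b)
        = (\<Sum>i\<le>d. \<Sum>l\<le>D. (\<Sum>r\<le>n. (\<Sum>s\<le>d. A1 k s * a s i r) * h b l (n - r)) * (W i l * g (i + l)))"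
    proof -
      have "(\<Sum>s\<le>d. A1 k s * G n s b) = (\<Sum>i\<le>d. \<Sum>s\<le>d. A1 k s * (\<Sum>l\<le>D. (\<Sum>r\<le>n. a s i r * h b l (n - r)) * (W i l * g (i + l))))"
        unfolding G_def by (subst sum_distrib_left) (rule sum.swap)
      also have "\<dots> = (\<Sum>i\<le>d. \<Sum>l\<le>D. \<Sum>s\<le>d. A1 k s * ((\<Sum>r\<le>n. a s i r * h b l (n - r)) * (W i l * g (i + l))))"
        by (rule sum.cong[OF refl]) (simp only: sum_distrib_left, rule sum.swap)
      also have "\<dots> = (\<Sum>i\<le>d. \<Sum>l\<le>D. (\<Sum>s\<le>d. \<Sum>r\<le>n. A1 k s * a s i r * h b l (n - r)) * (W i l * g (i + l)))"
        unfolding sum_distrib_left sum_distrib_right by (simp add: mult_ac)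
      also have "\<dots> = (\<Sum>i\<le>d. \<Sum>l\<le>D. (\<Sum>r\<le>n. (\<Sum>s\<le>d. A1 k s * a s i r) * h b l (n - r)) * (W i l * g (i + l)))"
        unfolding sum_distrib_right by (rule sum.cong[OF refl], rule sum.cong[OF refl], rule sum.swap)
      finally show ?thesis .
    qed
    also have "(\<Sum>l\<le>D. A2 b l * G n k l)
        = (\<Sum>i\<le>d. \<Sum>l\<le>D. (\<Sum>r\<le>n. a k i r * (\<Sum>s\<le>D. A2 b s * h s l (n - r))) * (W i l * g (i + l)))"
    proof -
      have "(\<Sum>s\<le>D. A2 b s * G n k s) = (\<Sum>i\<le>d. \<Sum>s\<le>D. A2 b s * (\<Sum>l\<le>D. (\<Sum>r\<le>n. a k i r * h s l (n - r)) * (W i l * g (i + l))))"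
        unfolding G_def by (subst sum_distrib_left) (rule sum.swap)
      also have "\<dots> = (\<Sum>i\<le>d. \<Sum>l\<le>D. \<Sum>s\<le>D. A2 b s * ((\<Sum>r\<le>n. a k i r * h s l (n - r)) * (W i l * g (i + l))))"
        by (rule sum.cong[OF refl]) (simp only: sum_distrib_left, rule sum.swap)
      also have "\<dots> = (\<Sum>i\<le>d. \<Sum>l\<le>D. (\<Sum>s\<le>D. \<Sum>r\<le>n. a k i r * (A2 b s * h s l (n - r))) * (W i l * g (i + l)))"
        unfolding sum_distrib_left sum_distrib_right by (simp add: mult_ac)
      also have "\<dots> = (\<Sum>i\<le>d. \<Sum>l\<le>D. (\<Sum>r\<le>n. a k i r * (\<Sum>s\<le>D. A2 b s * h s l (n - r))) * (W i l * g (i + l)))"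
        unfolding sum_distrib_left by (rule sum.cong[OF refl], rule sum.cong[OF refl], rule arg_cong2[where f="(*)"], rule sum.swap, rule refl)
      finally show ?thesis .
    qed
    also have "(\<Sum>i\<le>d. \<Sum>l\<le>D. (\<Sum>r\<le>n. (\<Sum>s\<le>d. A1 k s * a s i r) * h b l (n - r)) * (W i l * g (i + l)))
       + (\<Sum>i\<le>d. \<Sum>l\<le>D. (\<Sum>r\<le>n. a k i r * (\<Sum>s\<le>D. A2 b s * h s l (n - r))) * (W i l * g (i + l)))
       = (\<Sum>i\<le>d. \<Sum>l\<le>D. (of_nat (Suc n) * (\<Sum>r\<le>Suc n. a k i r * h b l (Suc n - r))) * (W i l * g (i + l)))"
      unfolding cauchy_coeff_Suc unfolding sum.distrib[symmetric] distrib_right[symmetric]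
      unfolding a_def h_def mpow_fact_Suc ..
    also have "\<dots> = of_nat (Suc n) * G (Suc n) k b"
      by (simp only: G_def mult.assoc sum_distrib_left[where A="{..d}"] sum_distrib_left[where A="{..D}"])
    finally show ?case by (simp del: of_nat_Suc)
  qed
  have "(\<lambda>n. F n k b) sums (W k b * (\<Sum>r\<le>d + D. mexp (d + D) A (k + b) r * g r))"
    unfolding F_def f_def using assms(2,3) by (intro sums_mult sums_sum sums_mult2 mexp_sums) auto
  moreover have "(\<lambda>n. G n k b) sums (\<Sum>i\<le>d. \<Sum>l\<le>D. mexp d A1 k i * mexp D A2 b l * (W i l * g (i + l)))"
    unfolding G_def
  proof (intro sums_sum sums_mult2)
    fix i l assume "i \<in> {..d}" "l \<in> {..D}"
    then show "(\<lambda>n. \<Sum>r\<le>n. a k i r * h b l (n - r)) sums (mexp d A1 k i * mexp D A2 b l)"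
      unfolding a_def h_def mexp_def
      using Cauchy_product_sums[OF mpow_summable[of k d i A1] mpow_summable[of b D l A2]] assms(2,3)
      by simp
  qed
  ultimately show ?thesis unfolding FG[OF assms(2,3)] by (rule sums_unique2)
qed

section \<open>The spin representations\<close>

text \<open>The norm of the sum of all product states of d spins 1/2 with exactly k spins
  down.\<close>

definition wt :: "nat \<Rightarrow> nat \<Rightarrow> complex" where
  "wt d k = complex_of_real (sqrt (real (d choose k)))"

lemma wt_nonzero: "k \<le> d \<Longrightarrow> wt d k \<noteq> 0"
  by (simp add: wt_def)

lemma wt_ends [simp]: "wt d 0 = 1" "wt d d = 1"
  by (simp_all add: wt_def)

lemma binomial_neighbour: "k < d \<Longrightarrow> Suc k * (d choose Suc k) = (d - k) * (d choose k)"
  using binomial_absorption[of k d] binomial_absorb_comp[of d k] by simp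

lemma wt_raise:
  assumes "k < d"
  shows "complex_of_real (sqrt (real (Suc k) * (real d - real k))) * wt d (Suc k) = of_real (real d - real k) * wt d k"
proof -
  have "real (Suc k) * real (d choose Suc k) = (real d - real k) * real (d choose k)"
    using binomial_neighbour[OF assms] assms by (metis of_nat_diff of_nat_mult order_less_imp_le)
  then have "sqrt (real (Suc k) * (real d - real k)) * sqrt (real (d choose Suc k))
      = sqrt ((real d - real k)^2 * real (d choose k))"
    unfolding real_sqrt_mult[symmetric] power2_eq_square by (simp add: mult_ac)
  also have "\<dots> = (real d - real k) * sqrt (real (d choose k))"
    using assms by (simp add: real_sqrt_mult)
  finally show ?thesis unfolding wt_def by (metis of_real_mult)
qed

lemma wt_lower:
  assumes "k < d"
  shows "complex_of_real (sqrt (real (Suc k) * (real d - real k))) * wt d k = of_nat (Suc k) * wt d (Suc k)"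
proof -
  have "real (Suc k) * real (d choose Suc k) = (real d - real k) * real (d choose k)"
    using binomial_neighbour[OF assms] assms by (metis of_nat_diff of_nat_mult order_less_imp_le)
  then have "sqrt (real (Suc k) * (real d - real k)) * sqrt (real (d choose k))
      = sqrt ((real (Suc k))^2 * real (d choose Suc k))"
    unfolding real_sqrt_mult[symmetric] power2_eq_square by (simp add: mult_ac del: of_nat_Suc)
  also have "\<dots> = real (Suc k) * sqrt (real (d choose Suc k))"
    by (simp add: real_sqrt_mult)
  finally show ?thesis unfolding wt_def by (metis of_real_mult of_real_of_nat_eq)
qed

text \<open>In the rescaled basis \<open>wt d k\<close> the angular momentum matrices are those of
  first-order differential operators on polynomials, free of square roots.\<close>

lemma nJ_apply:
  assumes "k \<le> d"
  shows "(\<Sum>r\<le>d. nJ a b c d k r * (wt d r * g r)) = wt d k *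
     ((of_real a - \<i> * of_real b) / 2 * of_real (real d - real k) * g (Suc k)
      + (of_real a + \<i> * of_real b) / 2 * of_nat k * g (k - 1)
      + of_real (c * (real d / 2 - real k)) * g k)"
proof -
  define u where "u = (of_real a - \<i> * of_real b) / (2::complex)"
  define v where "v = (of_real a + \<i> * of_real b) / (2::complex)"
  have nJ: "nJ a b c d k r * (wt d r * g r)
     = (if r = Suc k then u * of_real (sqrt (real (Suc k) * (real d - real k))) * (wt d (Suc k) * g (Suc k)) else 0)
     + (if r = k - 1 then (if k = 0 then 0 else v * of_real (sqrt (real k * (real d - real k + 1))) * (wt d (k - 1) * g (k - 1))) else 0)
     + (if r = k then of_real (c * (real d / 2 - real k)) * (wt d k * g k) else 0)" for r
    by (cases k) (auto simp: nJ_def Jx_def Jy_def Jz_def Jm_def Jp_def u_def v_def field_simps)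
  have "(\<Sum>r\<le>d. nJ a b c d k r * (wt d r * g r))
     = (if Suc k \<le> d then u * of_real (sqrt (real (Suc k) * (real d - real k))) * (wt d (Suc k) * g (Suc k)) else 0)
     + (if k = 0 then 0 else v * of_real (sqrt (real k * (real d - real k + 1))) * (wt d (k - 1) * g (k - 1)))
     + of_real (c * (real d / 2 - real k)) * (wt d k * g k)"
    unfolding nJ sum.distrib using assms by (simp del: of_nat_Suc)
  also have "(if Suc k \<le> d then u * of_real (sqrt (real (Suc k) * (real d - real k))) * (wt d (Suc k) * g (Suc k)) else 0)
      = wt d k * (u * of_real (real d - real k) * g (Suc k))"
    using wt_raise[of k d] assms by (cases "k = d") (auto simp: mult_ac simp del: of_nat_Suc of_real_diff)
  also have "(if k = 0 then 0 else v * of_real (sqrt (real k * (real d - real k + 1))) * (wt d (k - 1) * g (k - 1)))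
      = wt d k * (v * of_nat k * g (k - 1))"
  proof (cases k)
    case (Suc j)
    then have "complex_of_real (sqrt (real k * (real d - real k + 1))) * wt d (k - 1) = of_nat k * wt d k"
      using wt_lower[of j d] assms by simp
    then show ?thesis using Suc by (simp add: mult_ac del: of_nat_Suc)
  qed simp
  finally show ?thesis unfolding u_def v_def by (simp only: distrib_left mult_ac)
qed

lemma nJ_hermitian: "cnj (nJ a b c d l k) = nJ a b c d k l"
  by (auto simp: nJ_def Jx_def Jy_def Jz_def Jm_def field_simps)

lemma nJ_scale: "nJ (t * a) (t * b) (t * c) d k l = of_real t * nJ a b c d k l"
  by (simp add: nJ_def algebra_simps)

definition spin_rep :: "real \<Rightarrow> real \<Rightarrow> real \<Rightarrow> nat \<Rightarrow> nat \<Rightarrow> nat \<Rightarrow> complex" where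
  "spin_rep t1 t2 t3 d = mexp d (\<lambda>k l. \<i> * nJ t1 t2 t3 d k l)"

lemma Trep_block:
  "Trep t1 t2 t3 (d, k) (d, l) = (if k \<le> d \<and> l \<le> d then spin_rep t1 t2 t3 d k l else 0)"
  by (simp add: Trep_def spin_rep_def valid_def)

lemma spin_rep_adjoint:
  assumes "k \<le> d" "l \<le> d"
  shows "cnj (spin_rep t1 t2 t3 d l k) = mexp d (\<lambda>i j. - (\<i> * nJ t1 t2 t3 d i j)) k l"
  unfolding spin_rep_def using assms by (intro mexp_adjoint) (auto simp: nJ_hermitian)

lemma spin_rep_unitary:
  assumes "k \<le> d" "l \<le> d"
  shows "(\<Sum>m\<le>d. cnj (spin_rep t1 t2 t3 d m k) * spin_rep t1 t2 t3 d m l) = (if k = l then 1 else 0)"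
proof -
  have "(\<Sum>m\<le>d. cnj (spin_rep t1 t2 t3 d m k) * spin_rep t1 t2 t3 d m l)
     = (\<Sum>m\<le>d. mexp d (\<lambda>i j. - (\<i> * nJ t1 t2 t3 d i j)) k m
          * mexp d (\<lambda>i j. - (- (\<i> * nJ t1 t2 t3 d i j))) m l)"
    using spin_rep_adjoint[OF assms(1)] by (intro sum.cong refl) (simp add: spin_rep_def)
  also have "\<dots> = (if k = l then 1 else 0)" by (rule mexp_minus_mult[OF assms])
  finally show ?thesis .
qed

lemma spin_rep_eigen:
  assumes "\<And>i. i \<le> d \<Longrightarrow> (\<Sum>l\<le>d. nJ a b c d i l * v l) = \<mu> * v i" "k \<le> d"
  shows "(\<Sum>l\<le>d. spin_rep (t * a) (t * b) (t * c) d k l * v l) = exp (\<i> * of_real t * \<mu>) * v k"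
    and "(\<Sum>l\<le>d. cnj (spin_rep (t * a) (t * b) (t * c) d l k) * v l) = exp (- (\<i> * of_real t * \<mu>)) * v k"
proof -
  have eig: "(\<Sum>l\<le>d. (x * nJ (t * a) (t * b) (t * c) d i l) * v l) = x * of_real t * \<mu> * v i" if "i \<le> d" for i x
    using assms(1)[OF that] by (simp add: nJ_scale mult.assoc flip: sum_distrib_left)
  show "(\<Sum>l\<le>d. spin_rep (t * a) (t * b) (t * c) d k l * v l) = exp (\<i> * of_real t * \<mu>) * v k"
    unfolding spin_rep_def by (rule mexp_eigen[OF eig assms(2)])
  have "(\<Sum>l\<le>d. - (\<i> * nJ (t * a) (t * b) (t * c) d i l) * v l) = - (\<i> * of_real t * \<mu>) * v i" if "i \<le> d" for i
    using eig[OF that, of "-\<i>"] by simp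
  from mexp_eigen[OF this assms(2)]
  show "(\<Sum>l\<le>d. cnj (spin_rep (t * a) (t * b) (t * c) d l k) * v l) = exp (- (\<i> * of_real t * \<mu>)) * v k"
    using assms(2) by (simp add: spin_rep_adjoint)
qed

section \<open>The stretched coupling of two spins\<close>

text \<open>The Clebsch-Gordan coefficients of the embedding of spin \<open>(d + D) / 2\<close> as the
  stretched component of spin \<open>d / 2\<close> tensor spin \<open>D / 2\<close>.\<close>

definition dicke :: "nat \<Rightarrow> nat \<Rightarrow> nat \<Rightarrow> nat \<Rightarrow> complex" where
  "dicke d D k b = wt d k * wt D b / wt (d + D) (k + b)"

lemma cnj_dicke [simp]: "cnj (dicke d D k b) = dicke d D k b"
  by (simp add: dicke_def wt_def)

text \<open>In the rescaled basis the coefficients of \<open>nJ\<close> are linear in the numbers d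
  - k and k of spins up and down, and these numbers add when d + D spins are split: the Leibniz rule
  for first-order operators.\<close>

lemma dicke_nJ:
  assumes "k \<le> d" "b \<le> D"
  shows "dicke d D k b * (\<Sum>r\<le>d + D. (\<i> * nJ t1 t2 t3 (d + D) (k + b) r) * g r)
     = (\<Sum>i\<le>d. (\<i> * nJ t1 t2 t3 d k i) * (dicke d D i b * g (i + b)))
      + (\<Sum>l\<le>D. (\<i> * nJ t1 t2 t3 D b l) * (dicke d D k l * g (k + l)))"
proof -
  define h where "h = (\<lambda>r. g r / wt (d + D) r)"
  have g: "g r = wt (d + D) r * h r" if "r \<le> d + D" for r
    using wt_nonzero[OF that] by (simp add: h_def)
  define u where "u = (of_real t1 - \<i> * of_real t2) / (2::complex)"
  define v where "v = (of_real t1 + \<i> * of_real t2) / (2::complex)"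
  have "(\<Sum>r\<le>d + D. (\<i> * nJ t1 t2 t3 (d + D) (k + b) r) * g r)
      = \<i> * (\<Sum>r\<le>d + D. nJ t1 t2 t3 (d + D) (k + b) r * (wt (d + D) r * h r))"
    unfolding sum_distrib_left by (intro sum.cong) (auto simp: g)
  also have "\<dots> = \<i> * (wt (d + D) (k + b) * (u * of_real (real (d + D) - real (k + b)) * h (Suc (k + b))
      + v * of_nat (k + b) * h (k + b - 1) + of_real (t3 * (real (d + D) / 2 - real (k + b))) * h (k + b)))"
    using assms by (simp only: nJ_apply u_def v_def add_mono)
  finally have L: "dicke d D k b * (\<Sum>r\<le>d + D. (\<i> * nJ t1 t2 t3 (d + D) (k + b) r) * g r)
      = \<i> * wt d k * wt D b * (u * of_real (real (d + D) - real (k + b)) * h (Suc (k + b))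
      + v * of_nat (k + b) * h (k + b - 1) + of_real (t3 * (real (d + D) / 2 - real (k + b))) * h (k + b))"
    using assms wt_nonzero[of "k + b" "d + D"] by (simp add: dicke_def)
  have "(\<Sum>i\<le>d. (\<i> * nJ t1 t2 t3 d k i) * (dicke d D i b * g (i + b)))
      = \<i> * wt D b * (\<Sum>i\<le>d. nJ t1 t2 t3 d k i * (wt d i * h (i + b)))"
    unfolding sum_distrib_left by (intro sum.cong) (auto simp: h_def dicke_def)
  then have R1: "(\<Sum>i\<le>d. (\<i> * nJ t1 t2 t3 d k i) * (dicke d D i b * g (i + b)))
      = \<i> * wt d k * wt D b * (u * of_real (real d - real k) * h (Suc k + b)
        + v * of_nat k * h (k - 1 + b) + of_real (t3 * (real d / 2 - real k)) * h (k + b))"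
    unfolding nJ_apply[OF assms(1)] u_def v_def by (simp only: mult_ac)
  have "(\<Sum>l\<le>D. (\<i> * nJ t1 t2 t3 D b l) * (dicke d D k l * g (k + l)))
      = \<i> * wt d k * (\<Sum>l\<le>D. nJ t1 t2 t3 D b l * (wt D l * h (k + l)))"
    unfolding sum_distrib_left by (intro sum.cong) (auto simp: h_def dicke_def)
  then have R2: "(\<Sum>l\<le>D. (\<i> * nJ t1 t2 t3 D b l) * (dicke d D k l * g (k + l)))
      = \<i> * wt d k * wt D b * (u * of_real (real D - real b) * h (k + Suc b)
        + v * of_nat b * h (k + (b - 1)) + of_real (t3 * (real D / 2 - real b)) * h (k + b))"
    unfolding nJ_apply[OF assms(2)] u_def v_def by (simp only: mult_ac)
  \<comment> \<open>Truncated subtraction at 0 is harmless, since the term carries the factor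
    \<open>k\<close>, and likewise \<open>b\<close> below.\<close>
  have hk: "v * of_nat k * h (k - 1 + b) = v * of_nat k * h (k + b - 1)"
    by (cases k) simp_all
  have hb: "v * of_nat b * h (k + (b - 1)) = v * of_nat b * h (k + b - 1)"
    by (cases b) simp_all
  show ?thesis unfolding L R1 R2 hk hb distrib_left[symmetric]
    by (simp add: algebra_simps add_divide_distrib)
qed

lemma spin_rep_dicke:
  assumes "k \<le> d" "b \<le> D"
  shows "dicke d D k b * (\<Sum>r\<le>d + D. spin_rep t1 t2 t3 (d + D) (k + b) r * g r)
    = (\<Sum>i\<le>d. \<Sum>l\<le>D. spin_rep t1 t2 t3 d k i * spin_rep t1 t2 t3 D b l * (dicke d D i l * g (i + l)))"
  unfolding spin_rep_def by (rule mexp_intertwine[OF dicke_nJ assms])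

text \<open>The squared coefficients with k + b = m sum to 1 by Vandermonde's identity. The
  arbitrary \<open>g\<close> allows the use for the diagonal of an operator, that is, for traces
  over a block.\<close>

lemma dicke_isometry:
  fixes g :: "nat \<Rightarrow> complex"
  shows "(\<Sum>k\<le>d. \<Sum>b\<le>D. (dicke d D k b)^2 * g (k + b)) = (\<Sum>m\<le>d + D. g m)"
proof -
  have one: "(\<Sum>k\<le>d. \<Sum>b\<le>D. if k + b = m then (dicke d D k b)^2 else 0) = 1" if "m \<le> d + D" for m
  proof -
    have sq: "(wt n j)^2 = of_nat (n choose j)" for n j
      by (simp add: wt_def flip: of_real_power)
    have "(\<Sum>b\<le>D. if k + b = m then (dicke d D k b)^2 else 0)
        = (if k \<le> m then of_nat ((d choose k) * (D choose (m - k))) / of_nat ((d + D) choose m) else 0)" for k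
    proof -
      have "(\<Sum>b\<le>D. if k + b = m then (dicke d D k b)^2 else 0)
          = (\<Sum>b\<le>D. if b = m - k then (if k \<le> m then (dicke d D k (m - k))^2 else 0) else 0)"
        by (intro sum.cong) auto
      then show ?thesis
        by (auto simp: dicke_def power_divide power_mult_distrib sq binomial_eq_0)
    qed
    then have "(\<Sum>k\<le>d. \<Sum>b\<le>D. if k + b = m then (dicke d D k b)^2 else 0)
        = (\<Sum>k\<le>d. if k \<le> m then of_nat ((d choose k) * (D choose (m - k))) / of_nat ((d + D) choose m) else 0)"
      by simp
    also have "\<dots> = (\<Sum>k\<in>{..d} \<inter> {..m}. of_nat ((d choose k) * (D choose (m - k))) / of_nat ((d + D) choose m))"
      by (subst sum.inter_restrict) auto
    also have "\<dots> = (\<Sum>k\<le>m. of_nat ((d choose k) * (D choose (m - k))) / of_nat ((d + D) choose m))"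
      by (intro sum.mono_neutral_left) (auto simp: binomial_eq_0)
    also have "\<dots> = of_nat (\<Sum>k\<le>m. (d choose k) * (D choose (m - k))) / of_nat ((d + D) choose m)"
      by (simp only: of_nat_sum sum_divide_distrib)
    finally show ?thesis using that by (simp add: vandermonde)
  qed
  have "(\<Sum>k\<le>d. \<Sum>b\<le>D. (dicke d D k b)^2 * g (k + b))
      = (\<Sum>k\<le>d. \<Sum>b\<le>D. \<Sum>m\<le>d + D. if m = k + b then (dicke d D k b)^2 * g m else 0)"
    by (intro sum.cong) auto
  also have "\<dots> = (\<Sum>k\<le>d. \<Sum>m\<le>d + D. \<Sum>b\<le>D. if m = k + b then (dicke d D k b)^2 * g m else 0)"
    by (rule sum.cong[OF refl], rule sum.swap)
  also have "\<dots> = (\<Sum>m\<le>d + D. \<Sum>k\<le>d. \<Sum>b\<le>D. if m = k + b then (dicke d D k b)^2 * g m else 0)"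
    by (rule sum.swap)
  also have "\<dots> = (\<Sum>m\<le>d + D. (\<Sum>k\<le>d. \<Sum>b\<le>D. if k + b = m then (dicke d D k b)^2 else 0) * g m)"
    unfolding sum_distrib_right by (intro sum.cong refl) auto
  also have "\<dots> = (\<Sum>m\<le>d + D. g m)" by (intro sum.cong) (auto simp: one)
  finally show ?thesis .
qed

section \<open>Coherent states\<close>

text \<open>Coordinates of the d-fold tensor power of the spinor (\<alpha>, \<beta>) in the
  symmetric basis.\<close>

definition coherent :: "complex \<Rightarrow> complex \<Rightarrow> nat \<Rightarrow> nat \<Rightarrow> complex" where
  "coherent \<alpha> \<beta> d k = wt d k * \<alpha> ^ (d - k) * \<beta> ^ k"

lemma coherent_split:
  assumes "k \<le> d" "b \<le> D"
  shows "dicke d D k b * coherent \<alpha> \<beta> (d + D) (k + b) = coherent \<alpha> \<beta> d k * coherent \<alpha> \<beta> D b"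
proof -
  have "d + D - (k + b) = (d - k) + (D - b)" using assms by simp
  then have "\<alpha> ^ (d + D - (k + b)) = \<alpha> ^ (d - k) * \<alpha> ^ (D - b)" by (simp only: power_add)
  then show ?thesis using assms wt_nonzero[of "k + b" "d + D"]
    by (simp add: dicke_def coherent_def power_add)
qed

lemma spin_rep_coherent_split:
  assumes "k \<le> d" "b \<le> D"
  shows "dicke d D k b * (\<Sum>r\<le>d + D. spin_rep t1 t2 t3 (d + D) (k + b) r * coherent \<alpha> \<beta> (d + D) r)
    = (\<Sum>i\<le>d. spin_rep t1 t2 t3 d k i * coherent \<alpha> \<beta> d i) * (\<Sum>l\<le>D. spin_rep t1 t2 t3 D b l * coherent \<alpha> \<beta> D l)"
  unfolding spin_rep_dicke[OF assms] sum_product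
  by (intro sum.cong refl) (simp add: coherent_split)

lemma spin_rep_zero: "spin_rep t1 t2 t3 0 0 0 = 1"
  using spin_rep_eigen(1)[of 0 t1 t2 t3 "\<lambda>_. 1" 0 0 1] by (simp add: nJ_def Jx_def Jy_def Jz_def Jm_def Jp_def)

text \<open>One spin 1/2 is peeled off at a time; at the two extreme indices the coupling
  coefficient is 1. Only these two components are needed, for the coherence that rules out
  raising.\<close>

lemma spin_rep_coherent_ends:
  shows "(\<Sum>l\<le>d. spin_rep t1 t2 t3 d 0 l * coherent \<alpha> \<beta> d l) = (\<Sum>l\<le>1. spin_rep t1 t2 t3 1 0 l * coherent \<alpha> \<beta> 1 l) ^ d"
    and "(\<Sum>l\<le>d. spin_rep t1 t2 t3 d d l * coherent \<alpha> \<beta> d l) = (\<Sum>l\<le>1. spin_rep t1 t2 t3 1 1 l * coherent \<alpha> \<beta> 1 l) ^ d"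
proof (induction d)
  case 0
  show "(\<Sum>l\<le>0. spin_rep t1 t2 t3 0 0 l * coherent \<alpha> \<beta> 0 l) = (\<Sum>l\<le>1. spin_rep t1 t2 t3 1 0 l * coherent \<alpha> \<beta> 1 l) ^ 0"
    "(\<Sum>l\<le>0. spin_rep t1 t2 t3 0 0 l * coherent \<alpha> \<beta> 0 l) = (\<Sum>l\<le>1. spin_rep t1 t2 t3 1 1 l * coherent \<alpha> \<beta> 1 l) ^ 0"
    by (simp_all add: spin_rep_zero coherent_def)
next
  case (Suc d)
  show "(\<Sum>l\<le>Suc d. spin_rep t1 t2 t3 (Suc d) 0 l * coherent \<alpha> \<beta> (Suc d) l) = (\<Sum>l\<le>1. spin_rep t1 t2 t3 1 0 l * coherent \<alpha> \<beta> 1 l) ^ Suc d"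
    unfolding power_Suc2 Suc(1)[symmetric]
    using spin_rep_coherent_split[of 0 d 0 1 t1 t2 t3 \<alpha> \<beta>] by (simp only: dicke_def) simp
  show "(\<Sum>l\<le>Suc d. spin_rep t1 t2 t3 (Suc d) (Suc d) l * coherent \<alpha> \<beta> (Suc d) l) = (\<Sum>l\<le>1. spin_rep t1 t2 t3 1 1 l * coherent \<alpha> \<beta> 1 l) ^ Suc d"
    unfolding power_Suc2 Suc(2)[symmetric]
    using spin_rep_coherent_split[of d d 1 1 t1 t2 t3 \<alpha> \<beta>] by (simp only: dicke_def) simp
qed

text \<open>Once both components of the rotated spinor are nonzero,
  \<open>spin_rep_coherent_ends\<close> makes the extreme components nonzero in every block.\<close>

lemma ex_spin_rep_generic:
  assumes "\<alpha> \<noteq> 0 \<or> \<beta> \<noteq> 0"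
  obtains t1 t2 t3 where
    "(\<Sum>l\<le>1. spin_rep t1 t2 t3 1 0 l * coherent \<alpha> \<beta> 1 l) \<noteq> 0"
    "(\<Sum>l\<le>1. spin_rep t1 t2 t3 1 1 l * coherent \<alpha> \<beta> 1 l) \<noteq> 0"
proof (cases "\<alpha> \<noteq> 0 \<and> \<beta> \<noteq> 0")
  case True
  \<comment> \<open>The spinor is already generic, so the trivial rotation suffices; the products
    with 0 match the form of \<open>spin_rep_eigen\<close>.\<close>
  have "(\<Sum>l\<le>1. spin_rep (0 * 0) (0 * 0) (0 * 0) 1 k l * coherent \<alpha> \<beta> 1 l) = exp (\<i> * of_real 0 * 0) * coherent \<alpha> \<beta> 1 k" if "k \<le> 1" for k
    using that by (intro spin_rep_eigen(1)) (auto simp: nJ_def)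
  from this[of 0] this[of 1] show ?thesis
    using True by (intro that[of 0 0 0]) (auto simp: coherent_def)
next
  case False
  \<comment> \<open>The axis is polar. A quarter turn about the x axis works, because all four
    entries of its matrix are nonzero.\<close>
  define z where "z = cis (pi / 4)"
  have z2: "z^2 = \<i>"
    by (simp add: z_def power2_eq_square cis_mult)
  then have z0: "z \<noteq> 0" by auto
  have zi: "exp (\<i> * of_real (pi / 2) * (-1 / 2)) = inverse z"
    by (simp add: z_def cis_conv_exp flip: exp_minus)
  let ?R = "spin_rep (pi / 2) 0 0 1"
  have Jx: "nJ 1 0 0 1 k l = (if k + l = 1 then 1 / 2 else 0)" if "k \<le> 1" "l \<le> 1" for k l
    using that by (auto simp: nJ_def Jx_def Jy_def Jz_def Jm_def Jp_def le_Suc_eq)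
  \<comment> \<open>The eigenvectors (1, 1) and (1, -1) of \<open>Jx\<close>, with eigenvalues 1/2
    and -1/2, give the row sums and row differences of the matrix.\<close>
  have "(\<Sum>l\<le>1. spin_rep (pi / 2 * 1) (pi / 2 * 0) (pi / 2 * 0) 1 k l * 1) = exp (\<i> * of_real (pi / 2) * (1 / 2)) * 1" if "k \<le> 1" for k
  proof (rule spin_rep_eigen(1)[where v="\<lambda>_. 1", OF _ that])
    fix i :: nat assume "i \<le> 1"
    then show "(\<Sum>l\<le>1. nJ 1 0 0 1 i l * 1) = 1 / 2 * 1"
      using Jx[of i 0] Jx[of i 1] by (cases "i = 0") auto
  qed
  then have p: "?R k 0 + ?R k 1 = z" if "k \<le> 1" for k
    using that by (simp add: z_def cis_conv_exp)
  have "(\<Sum>l\<le>1. spin_rep (pi / 2 * 1) (pi / 2 * 0) (pi / 2 * 0) 1 k l * (if l = 0 then 1 else -1)) = exp (\<i> * of_real (pi / 2) * (-1 / 2)) * (if k = 0 then 1 else -1)" if "k \<le> 1" for k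
  proof (rule spin_rep_eigen(1)[where v="\<lambda>l. if l = 0 then 1 else -1", OF _ that])
    fix i :: nat assume "i \<le> 1"
    then show "(\<Sum>l\<le>1. nJ 1 0 0 1 i l * (if l = 0 then 1 else -1)) = -1 / 2 * (if i = 0 then 1 else -1)"
      using Jx[of i 0] Jx[of i 1] by (cases "i = 0") auto
  qed
  then have m: "?R k 0 - ?R k 1 = inverse z * (if k = 0 then 1 else -1)" if "k \<le> 1" for k
    unfolding zi using that by simp
  have ne: "z + inverse z \<noteq> 0" "z - inverse z \<noteq> 0"
  proof -
    have "z * (z + inverse z) = \<i> + 1" "z * (z - inverse z) = \<i> - 1"
      using z0 z2 by (simp_all add: distrib_left right_diff_distrib power2_eq_square)
    moreover have "\<i> + 1 \<noteq> 0" "\<i> - 1 \<noteq> 0" by (auto simp: complex_eq_iff)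
    ultimately show "z + inverse z \<noteq> 0" "z - inverse z \<noteq> 0" by auto
  qed
  have "2 * ?R 0 0 = z + inverse z" "2 * ?R 0 1 = z - inverse z" "2 * ?R 1 0 = z - inverse z" "2 * ?R 1 1 = z + inverse z"
  proof -
    have "2 * x = s + d" "2 * y = s - d" if "x + y = s" "x - y = d" for x y s d :: complex
      using that by auto
    from this[OF p m, of 0] this[OF p m, of 1]
    show "2 * ?R 0 0 = z + inverse z" "2 * ?R 0 1 = z - inverse z" "2 * ?R 1 0 = z - inverse z" "2 * ?R 1 1 = z + inverse z"
      by simp_all
  qed
  then have "?R 0 0 \<noteq> 0" "?R 0 1 \<noteq> 0" "?R 1 0 \<noteq> 0" "?R 1 1 \<noteq> 0" using ne by auto
  then show ?thesis using False assms
    by (intro that[of "pi / 2" 0 0]) (auto simp: coherent_def)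
qed

text \<open>The eigenvalue equation is a three-term recurrence; along a non-polar axis it collapses
  to a geometric one with ratio \<open>(1 - nz) / (nx - i ny)\<close>, the stereographic coordinate of the axis.\<close>

lemma highest_weight_coherent:
  fixes nx ny nz :: real and e :: "nat \<Rightarrow> nat \<Rightarrow> complex"
  assumes unit: "nx^2 + ny^2 + nz^2 = 1"
    and e_norm: "\<forall>d. (\<Sum>k\<le>d. (cmod (e d k))^2) = 1"
    and e_eig: "\<forall>d. \<forall>k\<le>d. (\<Sum>l\<le>d. nJ nx ny nz d k l * e d l) = complex_of_real (real d / 2) * e d k"
  obtains \<alpha> \<beta> where "\<alpha> \<noteq> 0 \<or> \<beta> \<noteq> 0"
    "\<And>d. \<exists>c. cmod c = 1 \<and> (\<forall>k\<le>d. e d k = c * coherent \<alpha> \<beta> d k)"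
proof -
  have cm: "cmod z = 1" if "(cmod z)^2 = 1" for z
    using power2_eq_imp_eq[of "cmod z" 1] that by simp
  define \<nu> where "\<nu> = of_real nx - \<i> * of_real ny"
  define f where "f = (\<lambda>d k. e d k / wt d k)"
  have e: "e d k = wt d k * f d k" if "k \<le> d" for d k
    using wt_nonzero[OF that] by (simp add: f_def)
  have rec: "\<nu> * (of_nat d - of_nat k) * f d (Suc k) + cnj \<nu> * of_nat k * f d (k - 1)
      + of_real nz * (of_nat d - 2 * of_nat k) * f d k = of_nat d * f d k" if "k \<le> d" for d k
  proof -
    have "wt d k * (\<nu> / 2 * of_real (real d - real k) * f d (Suc k) + cnj \<nu> / 2 * of_nat k * f d (k - 1)
      + of_real (nz * (real d / 2 - real k)) * f d k) = (\<Sum>l\<le>d. nJ nx ny nz d k l * (wt d l * f d l))"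
      unfolding nJ_apply[OF that] by (simp add: \<nu>_def)
    also have "\<dots> = (\<Sum>l\<le>d. nJ nx ny nz d k l * e d l)"
      by (intro sum.cong) (auto simp: e)
    also have "\<dots> = wt d k * (of_real (real d / 2) * f d k)"
      using e_eig that by (simp add: e)
    finally have "\<nu> / 2 * of_real (real d - real k) * f d (Suc k) + cnj \<nu> / 2 * of_nat k * f d (k - 1)
      + of_real (nz * (real d / 2 - real k)) * f d k = of_real (real d / 2) * f d k"
      using wt_nonzero[OF that] by (simp only: mult_cancel_left simp_thms)
    from arg_cong[OF this, of "\<lambda>x. 2 * x"] show ?thesis by (simp add: algebra_simps diff_divide_distrib)
  qed
  show ?thesis
  proof (cases "\<nu> = 0")
    case False
    define \<rho> where "\<rho> = (1 - of_real nz) / \<nu>"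
    \<comment> \<open>The unit length of the axis enters here: it makes the backward coefficient of
      the recurrence a multiple of the same ratio \<open>\<rho>\<close>.\<close>
    have "cnj \<nu> * \<nu> = of_real (nx^2 + ny^2)"
      by (simp add: \<nu>_def complex_eq_iff power2_eq_square)
    also have "nx^2 + ny^2 = (1 - nz) * (1 + nz)"
      using unit by (simp add: algebra_simps power2_eq_square)
    finally have cn: "cnj \<nu> = \<rho> * (1 + of_real nz)"
      using False by (simp add: \<rho>_def field_simps)
    \<comment> \<open>By \<open>cn\<close> and the induction hypothesis the backward term becomes a
      multiple of the middle one. A common factor \<open>d - Suc k\<close> remains, nonzero because
      \<open>Suc k < d\<close>.\<close>
    have step: "f d (Suc k) = \<rho> * f d k" if "k < d" for d k
      using that
    proof (induction k)
      case 0
      then have "of_nat d * (\<nu> * f d (Suc 0)) = of_nat d * ((1 - of_real nz) * f d 0)"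
        using rec[of 0 d] by (simp add: algebra_simps)
      then have "\<nu> * f d (Suc 0) = (1 - of_real nz) * f d 0" using 0 by simp
      then show ?case using False by (simp add: \<rho>_def field_simps)
    next
      case (Suc k)
      have "\<nu> * (of_nat d - of_nat (Suc k)) * f d (Suc (Suc k))
          = (of_nat d - of_real nz * (of_nat d - 2 * of_nat (Suc k))) * f d (Suc k) - cnj \<nu> * of_nat (Suc k) * f d k"
        using rec[of "Suc k" d] Suc by (simp add: algebra_simps)
      also have "cnj \<nu> * of_nat (Suc k) * f d k = (1 + of_real nz) * of_nat (Suc k) * f d (Suc k)"
        using Suc unfolding cn by (simp add: mult_ac)
      finally have "(of_nat d - of_nat (Suc k)) * (\<nu> * f d (Suc (Suc k))) = (of_nat d - of_nat (Suc k)) * ((1 - of_real nz) * f d (Suc k))"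
        by (simp add: algebra_simps)
      moreover have "(of_nat d - of_nat (Suc k) :: complex) \<noteq> 0"
        using Suc by (metis eq_iff_diff_eq_0 less_irrefl of_nat_eq_iff)
      ultimately have "\<nu> * f d (Suc (Suc k)) = (1 - of_real nz) * f d (Suc k)" by (metis mult_cancel_left)
      then show ?case using False by (simp add: \<rho>_def field_simps)
    qed
    have geo: "f d k = \<rho> ^ k * f d 0" if "k \<le> d" for d k
      using that by (induction k) (auto simp: step)
    \<comment> \<open>Normalises the spinor (1, \<rho>); by the binomial theorem its tensor powers
      are then unit vectors for all d at once.\<close>
    define r where "r = 1 / sqrt (1 + (cmod \<rho>)^2)"
    have rpos: "0 < r" by (simp add: r_def add_pos_nonneg)
    have r2: "r^2 * (1 + (cmod \<rho>)^2) = 1"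
    proof -
      have "0 < 1 + (cmod \<rho>)^2" by (simp add: add_pos_nonneg)
      then show ?thesis by (simp add: r_def power_divide)
    qed
    have "\<exists>c. cmod c = 1 \<and> (\<forall>k\<le>d. e d k = c * coherent (of_real r) (\<rho> * of_real r) d k)" for d
    proof -
      define c where "c = f d 0 / of_real r ^ d"
      have "1 = (\<Sum>k\<le>d. (cmod (e d k))^2)" using e_norm by simp
      also have "\<dots> = (\<Sum>k\<le>d. (cmod (f d 0))^2 * (of_nat (d choose k) * ((cmod \<rho>)^2)^k * 1^(d - k)))"
      proof (intro sum.cong refl)
        fix k assume "k \<in> {..d}"
        then have "e d k = wt d k * (\<rho> ^ k * f d 0)" using e[of k d] geo[of k d] by simp
        moreover have "(cmod (wt d k))^2 = real (d choose k)" by (simp add: wt_def)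
        ultimately show "(cmod (e d k))^2 = (cmod (f d 0))^2 * (of_nat (d choose k) * ((cmod \<rho>)^2)^k * 1^(d - k))"
          by (simp add: norm_mult norm_power power_mult_distrib mult_ac flip: power_mult)
      qed
      also have "\<dots> = (cmod (f d 0))^2 * (1 + (cmod \<rho>)^2)^d"
        by (subst add.commute) (simp only: binomial_ring sum_distrib_left)
      finally have n1: "(cmod (f d 0))^2 * (1 + (cmod \<rho>)^2)^d = 1" by simp
      have "(cmod c)^2 = (cmod (f d 0))^2 / (r^2)^d"
        using rpos by (simp add: c_def norm_divide norm_power power_divide mult.commute flip: power_mult)
      also have "\<dots> = (cmod (f d 0))^2 * (1 + (cmod \<rho>)^2)^d"
      proof -
        have "(r^2)^d * (1 + (cmod \<rho>)^2)^d = 1" using r2 by (simp flip: power_mult_distrib)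
        from inverse_unique[OF this] show ?thesis by (simp only: divide_inverse)
      qed
      finally have "cmod c = 1" using n1 by (intro cm) simp
      moreover have "e d k = c * coherent (of_real r) (\<rho> * of_real r) d k" if "k \<le> d" for k
      proof -
        have "of_real r ^ (d - k) * of_real r ^ k = (of_real r ^ d :: complex)"
          using that by (simp flip: power_add)
        then have "coherent (of_real r) (\<rho> * of_real r) d k = wt d k * \<rho> ^ k * of_real r ^ d"
          by (simp add: coherent_def power_mult_distrib mult_ac)
        then show ?thesis using that rpos by (simp add: e[OF that] geo[OF that] c_def)
      qed
      ultimately show ?thesis by blast
    qed
    from that[OF _ this] rpos show ?thesis by simp
  next
    \<comment> \<open>At a pole the eigenvalue equation is diagonal and leaves a single index:
      \<open>0\<close> at the north pole, \<open>d\<close> at the south pole.\<close>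
    case True
    then have xy: "nx = 0" "ny = 0" by (auto simp: \<nu>_def complex_eq_iff)
    then have "nz = 1 \<or> nz = -1" using unit by (simp add: power2_eq_1_iff)
    then show ?thesis
    proof
      assume nz: "nz = 1"
      have z: "e d k = 0" if "k \<le> d" "k \<noteq> 0" for d k
        using rec[OF that(1)] that by (simp add: True nz e algebra_simps)
      have "\<exists>c. cmod c = 1 \<and> (\<forall>k\<le>d. e d k = c * coherent 1 0 d k)" for d
      proof -
        have "1 = (\<Sum>k\<le>d. if k = 0 then (cmod (e d 0))^2 else 0)"
          using e_norm z by (subst e_norm[rule_format, of d, symmetric], intro sum.cong) auto
        then have "cmod (e d 0) = 1" by (intro cm) simp
        then show ?thesis using z by (intro exI[of _ "e d 0"]) (auto simp: coherent_def power_0_left)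
      qed
      from that[OF _ this] show ?thesis by simp
    next
      assume nz: "nz = -1"
      have z: "e d k = 0" if "k \<le> d" "k \<noteq> d" for d k
        using rec[OF that(1)] that by (simp add: True nz e algebra_simps)
      have "\<exists>c. cmod c = 1 \<and> (\<forall>k\<le>d. e d k = c * coherent 0 1 d k)" for d
      proof -
        have "1 = (\<Sum>k\<le>d. if k = d then (cmod (e d d))^2 else 0)"
          using e_norm z by (subst e_norm[rule_format, of d, symmetric], intro sum.cong) auto
        then have "cmod (e d d) = 1" by (intro cm) simp
        then show ?thesis using z by (intro exI[of _ "e d d"]) (auto simp: coherent_def power_0_left)
      qed
      from that[OF _ this] show ?thesis by simp
    qed
  qed
qed

section \<open>Vectors with one component per block\<close>

text \<open>Free amplitudes admit single blocks and tails of a superposition besides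
  \<open>hstate\<close>.\<close>

definition block_vec :: "(nat \<Rightarrow> nat \<Rightarrow> complex) \<Rightarrow> (nat \<Rightarrow> complex) \<Rightarrow> vec" where
  "block_vec e s = (\<lambda>x. if valid x then s (fst x) * e (fst x) (snd x) else 0)"

lemma block_vec_pair: "block_vec e s (d, k) = (if k \<le> d then s d * e d k else 0)"
  by (simp add: block_vec_def valid_def)

lemma hstate_eq_block_vec: "hstate e p = block_vec e (\<lambda>d. of_real (sqrt (p d)))"
  by (simp add: hstate_def block_vec_def)

lemma block_vec_has_sum:
  assumes "\<forall>d. (\<Sum>k\<le>d. (cmod (e d k))^2) = 1" "(\<lambda>d. (cmod (s d))^2) sums N"
  shows "((\<lambda>x. (cmod (block_vec e s x))^2) has_sum N) UNIV"
proof -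
  have inner: "((\<lambda>k. (cmod (block_vec e s (d, k)))^2) has_sum (cmod (s d))^2) {..d}" for d
  proof -
    have "(\<Sum>k\<le>d. (cmod (block_vec e s (d, k)))^2) = (\<Sum>k\<le>d. (cmod (s d))^2 * (cmod (e d k))^2)"
      by (intro sum.cong) (auto simp: block_vec_pair norm_mult power_mult_distrib)
    then have "(\<Sum>k\<le>d. (cmod (block_vec e s (d, k)))^2) = (cmod (s d))^2"
      using assms(1) by (simp flip: sum_distrib_left)
    then show ?thesis using has_sum_finite[of "{..d}" "\<lambda>k. (cmod (block_vec e s (d, k)))^2"] by simp
  qed
  have outer: "((\<lambda>d. (cmod (s d))^2) has_sum N) UNIV"
    using assms(2) by (intro sums_nonneg_imp_has_sum) auto
  have "(\<lambda>x. (cmod (block_vec e s x))^2) summable_on Sigma UNIV (\<lambda>d. {..d})"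
    using inner outer by (intro summable_on_SigmaI) (auto simp: summable_on_def)
  then have "((\<lambda>x. (cmod (block_vec e s x))^2) has_sum N) (Sigma UNIV (\<lambda>d. {..d}))"
    using inner outer by (intro has_sum_SigmaI) auto
  then show ?thesis
    by (rule has_sum_cong_neutral[THEN iffD1, rotated -1]) (auto simp: block_vec_pair split: if_splits)
qed

lemma block_vec_l2:
  assumes "\<forall>d. (\<Sum>k\<le>d. (cmod (e d k))^2) = 1" "summable (\<lambda>d. (cmod (s d))^2)"
  shows "l2vec (block_vec e s)"
  using block_vec_has_sum[OF assms(1) summable_sums[OF assms(2)]]
  by (auto simp: l2vec_def summable_on_def) (simp add: block_vec_def)

lemma block_vec_trace:
  assumes "\<forall>d. (\<Sum>k\<le>d. (cmod (e d k))^2) = 1" "(\<lambda>d. (cmod (s d))^2) sums N"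
  shows "trace_op (outer (block_vec e s) (block_vec e s)) = of_real N"
  using has_sum_of_real[OF block_vec_has_sum[OF assms], where 'a = complex]
  unfolding trace_op_def outer_def complex_norm_square by (rule infsumI)

lemma outer_finite_rank: "l2vec u \<Longrightarrow> l2vec v \<Longrightarrow> finite_rank_op (outer u v)"
  unfolding finite_rank_op_def outer_def
  by (intro exI[of _ 1] exI[of _ "\<lambda>_. u"] exI[of _ "\<lambda>_. v"]) auto

lemma finite_rank_diag_summable:
  assumes "finite_rank_op X"
  shows "(\<lambda>x. X x x) summable_on UNIV"
proof -
  obtain N :: nat and u w where uw: "\<forall>i<N. l2vec (u i) \<and> l2vec (w i)"
    and X: "X = (\<lambda>x y. \<Sum>i<N. u i x * cnj (w i y))"
    using assms unfolding finite_rank_op_def by blast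
  have "(\<lambda>x. u i x * cnj (w i x)) summable_on UNIV" if "i < N" for i
  proof -
    have "(\<lambda>x. (cmod (u i x))^2 + (cmod (w i x))^2) summable_on UNIV"
      using uw that by (intro summable_on_add) (auto simp: l2vec_def)
    moreover have "norm (u i x * cnj (w i x)) \<le> (cmod (u i x))^2 + (cmod (w i x))^2" for x
    proof -
      have "2 * cmod (u i x) * cmod (w i x) \<le> (cmod (u i x))^2 + (cmod (w i x))^2"
        by (rule sum_squares_bound)
      moreover have "0 \<le> cmod (u i x) * cmod (w i x)" by simp
      ultimately show ?thesis unfolding norm_mult complex_mod_cnj by linarith
    qed
    ultimately have "(\<lambda>x. norm (u i x * cnj (w i x))) summable_on UNIV"
      by (intro Infinite_Sum.abs_summable_on_comparison_test'[where g="\<lambda>x. (cmod (u i x))^2 + (cmod (w i x))^2"]) auto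
    then show ?thesis by (rule abs_summable_summable)
  qed
  then have "(\<lambda>x. \<Sum>i<n. u i x * cnj (w i x)) summable_on UNIV" if "n \<le> N" for n
    using that by (induction n) (auto intro: summable_on_add)
  then show ?thesis unfolding X by simp
qed

lemma psd_op_diag:
  assumes "psd_op X"
  shows "cnonneg (X x x)"
  using assms[unfolded psd_op_def, rule_format, of "{x}" "\<lambda>_. 1"] by simp

lemma conj_op_Trep:
  "conj_op (Trep t1 t2 t3) X (d, k) (d', k') = (if k \<le> d \<and> k' \<le> d' then
     (\<Sum>i\<le>d. \<Sum>j\<le>d'. spin_rep t1 t2 t3 d k i * X (d, i) (d', j) * cnj (spin_rep t1 t2 t3 d' k' j)) else 0)"
  by (auto simp: conj_op_def Trep_block intro!: sum.cong)

section \<open>The operation lowering the spin by a fixed amount\<close>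

definition lower_coeff :: "(nat \<Rightarrow> complex) \<Rightarrow> nat \<Rightarrow> nat \<Rightarrow> bas \<Rightarrow> complex" where
  "lower_coeff c D b x = (if valid x then c (fst x) * dicke (fst x) D (snd x) b else 0)"

definition lower_shift :: "nat \<Rightarrow> nat \<Rightarrow> bas \<Rightarrow> bas" where
  "lower_shift D b x = (fst x + D, snd x + b)"

text \<open>Embed spin \<open>(d + D) / 2\<close> into spin \<open>d / 2\<close> tensor spin \<open>D / 2\<close>, weight block \<open>d\<close> by \<open>c d\<close>,
  and trace out the second factor; \<open>b\<close> runs over a basis of that factor.\<close>

definition lower_op :: "(nat \<Rightarrow> complex) \<Rightarrow> nat \<Rightarrow> opr \<Rightarrow> opr" where
  "lower_op c D X = (\<lambda>x y. \<Sum>b\<le>D. lower_coeff c D b x * cnj (lower_coeff c D b y)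
      * X (lower_shift D b x) (lower_shift D b y))"

lemma inj_lower_shift: "inj_on (lower_shift D b) F"
  by (auto simp: inj_on_def lower_shift_def prod_eq_iff)

lemma cnonneg_sum: "(\<And>i. i \<in> I \<Longrightarrow> cnonneg (f i)) \<Longrightarrow> cnonneg (sum f I)"
  by (auto simp: cnonneg_def intro!: sum_nonneg)

lemma sum_Sigma_pair:
  "finite A \<Longrightarrow> (\<And>x. x \<in> A \<Longrightarrow> finite (B x)) \<Longrightarrow> sum f (Sigma A B) = (\<Sum>x\<in>A. \<Sum>y\<in>B x. f (x, y))"
  by (simp add: sum.Sigma)

lemma sum_swap4:
  "(\<Sum>b\<in>B. \<Sum>i\<in>I. \<Sum>l\<in>L. \<Sum>i'\<in>I'. \<Sum>l'\<in>L'. f b i l i' l')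
     = (\<Sum>i\<in>I. \<Sum>l\<in>L. \<Sum>i'\<in>I'. \<Sum>l'\<in>L'. \<Sum>b\<in>B. f b i l i' l')"
  by (subst sum.swap, rule sum.cong[OF refl], subst sum.swap, rule sum.cong[OF refl],
      subst sum.swap, rule sum.cong[OF refl], rule sum.swap)

text \<open>For fixed \<open>b\<close> the map is a single Kraus term, a weighted restriction along
  the injection \<open>lower_shift D b\<close>, so positivity is preserved term by term.\<close>

lemma lower_op_psd:
  assumes "psd_block n M"
  shows "psd_block n (\<lambda>a a'. lower_op c D (M a a'))"
  unfolding psd_block_def
proof (intro allI impI)
  fix F :: "bas set" and w :: "nat \<Rightarrow> bas \<Rightarrow> complex"
  assume F: "finite F"
  \<comment> \<open>The test vector transported along the shift; the inverse is only evaluated on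
    the image of \<open>F\<close>.\<close>
  define u where "u = (\<lambda>b a z. cnj (lower_coeff c D b (inv_into F (lower_shift D b) z)) * w a (inv_into F (lower_shift D b) z))"
  have "(\<Sum>a<n. \<Sum>a'<n. \<Sum>x\<in>F. \<Sum>y\<in>F. cnj (w a x) * lower_op c D (M a a') x y * w a' y)
     = (\<Sum>a<n. \<Sum>a'<n. \<Sum>x\<in>F. \<Sum>y\<in>F. \<Sum>b\<le>D. cnj (u b a (lower_shift D b x)) * M a a' (lower_shift D b x) (lower_shift D b y) * u b a' (lower_shift D b y))"
    unfolding lower_op_def sum_distrib_left sum_distrib_right
    by (intro sum.cong refl) (simp add: u_def inv_into_f_f[OF inj_lower_shift] mult_ac)
  also have "\<dots> = (\<Sum>b\<le>D. \<Sum>a<n. \<Sum>a'<n. \<Sum>x\<in>F. \<Sum>y\<in>F. cnj (u b a (lower_shift D b x)) * M a a' (lower_shift D b x) (lower_shift D b y) * u b a' (lower_shift D b y))"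
    by (rule sum_swap4[symmetric])
  also have "\<dots> = (\<Sum>b\<le>D. \<Sum>a<n. \<Sum>a'<n. \<Sum>x\<in>lower_shift D b ` F. \<Sum>y\<in>lower_shift D b ` F. cnj (u b a x) * M a a' x y * u b a' y)"
    by (simp add: sum.reindex[OF inj_lower_shift])
  also have "cnonneg \<dots>"
    by (rule cnonneg_sum, rule assms[unfolded psd_block_def, rule_format]) (simp add: F)
  finally show "cnonneg (\<Sum>a<n. \<Sum>a'<n. \<Sum>x\<in>F. \<Sum>y\<in>F. cnj (w a x) * lower_op c D (M a a') x y * w a' y)" .
qed

lemma lower_op_trace:
  assumes c: "\<And>d. cmod (c d) \<le> 1" and X: "finite_rank_op X" "psd_op X" and F: "finite F"
  shows "(\<Sum>x\<in>F. Re (lower_op c D X x x)) \<le> Re (trace_op X)"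
proof -
  define g where "g = (\<lambda>x. Re (X x x))"
  have g0: "0 \<le> g x" for x
    using psd_op_diag[OF X(2)] by (simp add: g_def cnonneg_def)
  have diag: "Re (lower_op c D X x x) = (\<Sum>b\<le>D. (cmod (lower_coeff c D b x))^2 * g (lower_shift D b x))" for x
    unfolding lower_op_def g_def complex_norm_square[symmetric] by (simp flip: of_real_power)
  have inv0: "Re (lower_op c D X x x) = 0" if "\<not> valid x" for x
    using that by (simp add: lower_op_def lower_coeff_def)
  \<comment> \<open>\<open>F\<close> is enlarged to whole blocks, where the isometry identity
    applies; the diagonal is nonnegative, so the sum can only grow.\<close>
  obtain N where N: "\<forall>x\<in>F. fst x < N"
    using finite_nat_set_iff_bounded[of "fst ` F"] F by auto
  let ?T = "Sigma {..<N} (\<lambda>d. {..d})"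
  have "(\<Sum>x\<in>F. Re (lower_op c D X x x)) = (\<Sum>x\<in>F \<inter> ?T. Re (lower_op c D X x x))"
    using F N by (intro sum.mono_neutral_right) (auto simp: valid_def intro!: inv0)
  also have "\<dots> \<le> (\<Sum>x\<in>?T. Re (lower_op c D X x x))"
    by (intro sum_mono2) (auto simp: diag intro!: sum_nonneg mult_nonneg_nonneg g0)
  also have "\<dots> = (\<Sum>d<N. \<Sum>k\<le>d. \<Sum>b\<le>D. (cmod (lower_coeff c D b (d, k)))^2 * g (d + D, k + b))"
    unfolding diag by (simp add: sum_Sigma_pair lower_shift_def)
  also have "\<dots> \<le> (\<Sum>d<N. \<Sum>k\<le>d. \<Sum>b\<le>D. (cmod (dicke d D k b))^2 * g (d + D, k + b))"
  proof (intro sum_mono mult_right_mono g0 power_mono norm_ge_zero)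
    fix d k b :: nat assume "k \<in> {..d}"
    then show "cmod (lower_coeff c D b (d, k)) \<le> cmod (dicke d D k b)"
      using c[of d] by (simp add: lower_coeff_def valid_def norm_mult mult_left_le_one_le)
  qed
  also have "\<dots> = (\<Sum>d<N. \<Sum>m\<le>d + D. g (d + D, m))"
  proof (rule sum.cong[OF refl])
    fix d
    have sq: "(dicke d D k b)^2 = of_real ((cmod (dicke d D k b))^2)" for k b
      by (metis cnj_dicke complex_norm_square power2_eq_square)
    have "complex_of_real (\<Sum>k\<le>d. \<Sum>b\<le>D. (cmod (dicke d D k b))^2 * g (d + D, k + b))
        = (\<Sum>k\<le>d. \<Sum>b\<le>D. (dicke d D k b)^2 * of_real (g (d + D, k + b)))"
      by (simp add: sq)
    also have "\<dots> = of_real (\<Sum>m\<le>d + D. g (d + D, m))"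
      using dicke_isometry[of d D "\<lambda>m. of_real (g (d + D, m))"] by simp
    finally show "(\<Sum>k\<le>d. \<Sum>b\<le>D. (cmod (dicke d D k b))^2 * g (d + D, k + b)) = (\<Sum>m\<le>d + D. g (d + D, m))"
      by (simp only: of_real_eq_iff)
  qed
  \<comment> \<open>Distinct \<open>d\<close> read distinct blocks of \<open>X\<close>, so no
    diagonal entry is counted twice.\<close>
  also have "\<dots> = (\<Sum>d\<in>(\<lambda>d. d + D) ` {..<N}. \<Sum>m\<le>d. g (d, m))"
    by (subst sum.reindex) auto
  also have "\<dots> = (\<Sum>x\<in>Sigma ((\<lambda>d. d + D) ` {..<N}) (\<lambda>d. {..d}). g x)"
    by (simp add: sum_Sigma_pair)
  also have "\<dots> \<le> infsum g UNIV"
    using summable_on_Re[OF finite_rank_diag_summable[OF X(1)]] g0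
    by (intro finite_sum_le_infsum) (auto simp: g_def)
  also have "\<dots> = Re (trace_op X)"
    unfolding g_def trace_op_def by (rule infsum_Re[OF finite_rank_diag_summable[OF X(1)]])
  finally show ?thesis .
qed

lemma spin_rep_dicke_cnj:
  assumes "k \<le> d" "b \<le> D"
  shows "dicke d D k b * (\<Sum>r\<le>d + D. g r * cnj (spin_rep t1 t2 t3 (d + D) (k + b) r))
    = (\<Sum>i\<le>d. \<Sum>l\<le>D. cnj (spin_rep t1 t2 t3 d k i) * cnj (spin_rep t1 t2 t3 D b l) * (dicke d D i l * g (i + l)))"
  using arg_cong[OF spin_rep_dicke[OF assms, of t1 t2 t3 "\<lambda>r. cnj (g r)"], of cnj]
  by (simp add: mult.commute[of "g _"])

text \<open>The embedding turns a rotation into one of both factors, and the rotation of the second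
  factor disappears under the partial trace.\<close>

lemma lower_op_covariant:
  "lower_op c D (conj_op (Trep t1 t2 t3) X) = conj_op (Trep t1 t2 t3) (lower_op c D X)"
proof (intro ext)
  fix x y :: bas
  obtain d k d' k' where xy: "x = (d, k)" "y = (d', k')" by (cases x, cases y)
  show "lower_op c D (conj_op (Trep t1 t2 t3) X) x y = conj_op (Trep t1 t2 t3) (lower_op c D X) x y"
  proof (cases "k \<le> d \<and> k' \<le> d'")
    case False
    then show ?thesis unfolding xy conj_op_Trep by (auto simp: lower_op_def lower_coeff_def valid_def)
  next
    case True
    let ?S = "spin_rep t1 t2 t3"
    define G where "G = (\<lambda>m m'. X (d + D, m) (d' + D, m'))"
    define cc where "cc = c d * cnj (c d')"
    have "lower_op c D (conj_op (Trep t1 t2 t3) X) x y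
        = cc * (\<Sum>b\<le>D. dicke d D k b * (dicke d' D k' b *
            (\<Sum>m\<le>d + D. \<Sum>m'\<le>d' + D. ?S (d + D) (k + b) m * G m m' * cnj (?S (d' + D) (k' + b) m'))))"
      using True unfolding xy lower_op_def sum_distrib_left[of cc]
      by (intro sum.cong refl) (simp add: lower_coeff_def lower_shift_def valid_def conj_op_Trep G_def cc_def)
    also have "\<dots> = cc * (\<Sum>b\<le>D. \<Sum>i\<le>d. \<Sum>l\<le>D. \<Sum>i'\<le>d'. \<Sum>l'\<le>D.
         (?S d k i * dicke d D i l * G (i + l) (i' + l') * cnj (?S d' k' i') * dicke d' D i' l') * (cnj (?S D b l') * ?S D b l))"
    proof (intro arg_cong[of _ _ "(*) cc"] sum.cong[OF refl])
      fix b assume "b \<in> {..D}"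
      then have b: "b \<le> D" by simp
      have "dicke d D k b * (dicke d' D k' b *
            (\<Sum>m\<le>d + D. \<Sum>m'\<le>d' + D. ?S (d + D) (k + b) m * G m m' * cnj (?S (d' + D) (k' + b) m')))
          = dicke d D k b * (\<Sum>m\<le>d + D. ?S (d + D) (k + b) m * (dicke d' D k' b * (\<Sum>m'\<le>d' + D. G m m' * cnj (?S (d' + D) (k' + b) m'))))"
        by (simp only: sum_distrib_left sum_distrib_right mult_ac)
      also have "\<dots> = (\<Sum>i\<le>d. \<Sum>l\<le>D. ?S d k i * ?S D b l * (dicke d D i l *
           (\<Sum>i'\<le>d'. \<Sum>l'\<le>D. cnj (?S d' k' i') * cnj (?S D b l') * (dicke d' D i' l' * G (i + l) (i' + l')))))"
        using True b by (simp only: spin_rep_dicke spin_rep_dicke_cnj)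
      also have "\<dots> = (\<Sum>i\<le>d. \<Sum>l\<le>D. \<Sum>i'\<le>d'. \<Sum>l'\<le>D.
         (?S d k i * dicke d D i l * G (i + l) (i' + l') * cnj (?S d' k' i') * dicke d' D i' l') * (cnj (?S D b l') * ?S D b l))"
        by (simp only: sum_distrib_left sum_distrib_right mult_ac)
      finally show "dicke d D k b * (dicke d' D k' b *
            (\<Sum>m\<le>d + D. \<Sum>m'\<le>d' + D. ?S (d + D) (k + b) m * G m m' * cnj (?S (d' + D) (k' + b) m'))) = \<dots>" .
    qed
    also have "\<dots> = cc * (\<Sum>i\<le>d. \<Sum>l\<le>D. \<Sum>i'\<le>d'. \<Sum>l'\<le>D. \<Sum>b\<le>D.
         (?S d k i * dicke d D i l * G (i + l) (i' + l') * cnj (?S d' k' i') * dicke d' D i' l') * (cnj (?S D b l') * ?S D b l))"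
      by (rule arg_cong[of _ _ "(*) cc"], rule sum_swap4)
    \<comment> \<open>Summing over the basis \<open>b\<close> of the traced factor, unitarity forces
      \<open>l' = l\<close>.\<close>
    also have "\<dots> = cc * (\<Sum>i\<le>d. \<Sum>l\<le>D. \<Sum>i'\<le>d'. \<Sum>l'\<le>D.
         (?S d k i * dicke d D i l * G (i + l) (i' + l') * cnj (?S d' k' i') * dicke d' D i' l') * (if l' = l then 1 else 0))"
      by (intro arg_cong[of _ _ "(*) cc"] sum.cong[OF refl])
         (simp only: sum_distrib_left[symmetric] spin_rep_unitary atMost_iff)
    also have "\<dots> = cc * (\<Sum>i\<le>d. \<Sum>l\<le>D. \<Sum>i'\<le>d'. ?S d k i * dicke d D i l * G (i + l) (i' + l) * cnj (?S d' k' i') * dicke d' D i' l)"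
      by (intro arg_cong[of _ _ "(*) cc"] sum.cong[OF refl]) (simp add: if_distrib[of "(*) _"] cong: if_cong)
    also have "\<dots> = cc * (\<Sum>i\<le>d. \<Sum>i'\<le>d'. \<Sum>l\<le>D. ?S d k i * dicke d D i l * G (i + l) (i' + l) * cnj (?S d' k' i') * dicke d' D i' l)"
      by (intro arg_cong[of _ _ "(*) cc"] sum.cong[OF refl] sum.swap)
    also have "\<dots> = conj_op (Trep t1 t2 t3) (lower_op c D X) x y"
    proof -
      have "conj_op (Trep t1 t2 t3) (lower_op c D X) x y
         = (\<Sum>i\<le>d. \<Sum>i'\<le>d'. ?S d k i * (\<Sum>l\<le>D. cc * (dicke d D i l * dicke d' D i' l) * G (i + l) (i' + l)) * cnj (?S d' k' i'))"
        using True unfolding xy conj_op_Trep lower_op_def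
        by (simp, intro sum.cong refl) (simp add: lower_coeff_def lower_shift_def valid_def G_def cc_def mult_ac)
      also have "\<dots> = cc * (\<Sum>i\<le>d. \<Sum>i'\<le>d'. \<Sum>l\<le>D. ?S d k i * dicke d D i l * G (i + l) (i' + l) * cnj (?S d' k' i') * dicke d' D i' l)"
        by (simp only: sum_distrib_left sum_distrib_right mult_ac)
      finally show ?thesis by simp
    qed
    finally show ?thesis .
  qed
qed

lemma lower_op_invariant:
  assumes "\<And>d. cmod (c d) \<le> 1"
  shows "su2_invariant_operation (lower_op c D)"
  unfolding su2_invariant_operation_def
proof (intro conjI allI impI)
  show "lower_op c D X x y = 0" if "\<not> valid x \<or> \<not> valid y" for X x y
    using that by (auto simp: lower_op_def lower_coeff_def)
  show "lower_op c D (\<lambda>x y. X x y + Y x y) = (\<lambda>x y. lower_op c D X x y + lower_op c D Y x y)" for X Y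
    by (simp add: lower_op_def sum.distrib algebra_simps)
  show "lower_op c D (\<lambda>x y. a * X x y) = (\<lambda>x y. a * lower_op c D X x y)" for a X
    by (simp add: lower_op_def sum_distrib_left mult_ac)
qed (auto intro: lower_op_psd lower_op_trace[OF assms] lower_op_covariant)

lemma coherent_norm:
  assumes "(\<Sum>k\<le>d. (cmod (e k))^2) = 1" "cmod c = 1" "\<forall>k\<le>d. e k = c * coherent \<alpha> \<beta> d k"
  shows "(\<Sum>b\<le>d. coherent \<alpha> \<beta> d b * cnj (coherent \<alpha> \<beta> d b)) = 1"
proof -
  have "(\<Sum>b\<le>d. coherent \<alpha> \<beta> d b * cnj (coherent \<alpha> \<beta> d b)) = of_real (\<Sum>b\<le>d. (cmod (coherent \<alpha> \<beta> d b))^2)"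
    by (simp only: of_real_sum complex_norm_square)
  also have "(\<Sum>b\<le>d. (cmod (coherent \<alpha> \<beta> d b))^2) = (\<Sum>b\<le>d. (cmod (e b))^2)"
    using assms(2,3) by (intro sum.cong) (auto simp: norm_mult)
  finally show ?thesis using assms(1) by simp
qed

text \<open>The discarded factor is the spin D/2 coherent state whatever the block \<open>d\<close>.
  It therefore carries no record of \<open>d\<close>, and tracing it out leaves the coherences
  between blocks intact.\<close>

lemma achievable_lower:
  assumes e_norm: "\<forall>d. (\<Sum>k\<le>d. (cmod (e d k))^2) = 1"
    and coh: "\<And>d. \<exists>c. cmod c = 1 \<and> (\<forall>k\<le>d. e d k = c * coherent \<alpha> \<beta> d k)"
    and p: "\<And>d. 0 \<le> p d" and q: "\<And>d. 0 \<le> q d" and lam: "0 \<le> lam"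
    and le: "\<And>d. lam * q d \<le> p (d + D)"
  shows "achievable (hstate e p) (hstate e q) lam"
proof -
  obtain \<gamma> where \<gamma>: "\<And>d. cmod (\<gamma> d) = 1" "\<And>d k. k \<le> d \<Longrightarrow> e d k = \<gamma> d * coherent \<alpha> \<beta> d k"
    using coh by metis
  \<comment> \<open>The modulus is the ratio of target to source amplitude. The phases undo those of
    \<open>e\<close>, which the eigenvalue equation leaves free in each block separately.\<close>
  define c where "c = (\<lambda>d. of_real (sqrt (lam * q d) / sqrt (p (d + D))) * \<gamma> d / \<gamma> (d + D))"
  have "cmod (c d) \<le> 1" for d
  proof -
    have "cmod (c d) = sqrt (lam * q d) / sqrt (p (d + D))"
      using lam p q by (simp add: c_def norm_mult norm_divide \<gamma>(1) abs_mult)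
    also have "\<dots> \<le> 1"
      using le[of d] p[of "d + D"] by (cases "p (d + D) = 0") (simp_all add: divide_le_eq_1)
    finally show ?thesis .
  qed
  then have inv: "su2_invariant_operation (lower_op c D)" by (rule lower_op_invariant)
  define s where "s = (\<lambda>d. of_real (sqrt lam * sqrt (q d)) * \<gamma> d)"
  have cs: "c d * (of_real (sqrt (p (d + D))) * \<gamma> (d + D)) = s d" for d
  proof (cases "p (d + D) = 0")
    \<comment> \<open>Division by 0 gives weight 0, which is correct: \<open>le\<close> forces the
      target amplitude to vanish as well.\<close>
    case True
    then have "lam * q d = 0" using le[of d] mult_nonneg_nonneg[OF lam q[of d]] by linarith
    then show ?thesis using True by (auto simp: s_def)
  next
    case False
    have "\<gamma> (d + D) \<noteq> 0" using \<gamma>(1)[of "d + D"] by auto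
    then show ?thesis using False by (simp add: c_def s_def real_sqrt_mult)
  qed
  have psi: "lower_coeff c D b (d, k) * hstate e p (lower_shift D b (d, k))
      = (if k \<le> d then s d * coherent \<alpha> \<beta> d k * coherent \<alpha> \<beta> D b else 0)" if "b \<le> D" for b d k
  proof (cases "k \<le> d")
    case True
    have "lower_coeff c D b (d, k) * hstate e p (lower_shift D b (d, k))
       = c d * (of_real (sqrt (p (d + D))) * \<gamma> (d + D)) * (dicke d D k b * coherent \<alpha> \<beta> (d + D) (k + b))"
      using True that by (simp add: lower_coeff_def lower_shift_def hstate_eq_block_vec block_vec_pair valid_def \<gamma>(2) mult_ac)
    also have "\<dots> = s d * (coherent \<alpha> \<beta> d k * coherent \<alpha> \<beta> D b)"
      using True that by (simp only: cs coherent_split)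
    finally show ?thesis using True by (simp add: mult_ac)
  qed (simp add: lower_coeff_def valid_def)
  have "lower_op c D (outer (hstate e p) (hstate e p)) x y = of_real lam * outer (hstate e q) (hstate e q) x y" for x y
  proof -
    obtain d k d' k' where xy: "x = (d, k)" "y = (d', k')" by (cases x, cases y)
    have "lower_op c D (outer (hstate e p) (hstate e p)) x y
        = (\<Sum>b\<le>D. (lower_coeff c D b x * hstate e p (lower_shift D b x)) * cnj (lower_coeff c D b y * hstate e p (lower_shift D b y)))"
      unfolding lower_op_def outer_def by (simp add: mult_ac)
    also have "\<dots> = (\<Sum>b\<le>D. (if k \<le> d \<and> k' \<le> d' then s d * coherent \<alpha> \<beta> d k * cnj (s d' * coherent \<alpha> \<beta> d' k') else 0)
         * (coherent \<alpha> \<beta> D b * cnj (coherent \<alpha> \<beta> D b)))"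
      unfolding xy by (intro sum.cong[OF refl]) (simp only: psi atMost_iff, simp)
    also have "\<dots> = (if k \<le> d \<and> k' \<le> d' then s d * coherent \<alpha> \<beta> d k * cnj (s d' * coherent \<alpha> \<beta> d' k') else 0)"
      unfolding sum_distrib_left[symmetric]
      using coherent_norm[where d=D and e="e D" and c="\<gamma> D" and \<alpha>=\<alpha> and \<beta>=\<beta>] e_norm \<gamma> by simp
    also have "\<dots> = of_real lam * outer (hstate e q) (hstate e q) x y"
    proof -
      have "complex_of_real lam = of_real (sqrt lam) * of_real (sqrt lam)"
        using lam by (simp flip: of_real_mult)
      then show ?thesis
        unfolding xy outer_def hstate_eq_block_vec by (simp add: block_vec_pair \<gamma>(2) s_def mult_ac)
    qed
    finally show ?thesis .
  qed
  then show ?thesis unfolding achievable_def using inv by blast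
qed

section \<open>The Gram form of a completely positive map\<close>

lemma sum_mult_delta:
  fixes f :: "nat \<Rightarrow> complex"
  shows "(\<Sum>j\<le>b. f j * (if j = l then 1 else 0)) = (if l \<le> b then f l else 0)"
  by (simp add: if_distrib[of "(*) _"] cong: if_cong)

lemma cnonneg_norm_square: "cnonneg (z * cnj z)"
  by (simp add: cnonneg_def complex_mult_cnj)

lemma psd_block_outer: "psd_block n (\<lambda>i j. outer (z i) (z j))"
  unfolding psd_block_def
proof (intro allI impI)
  fix F :: "bas set" and w :: "nat \<Rightarrow> bas \<Rightarrow> complex"
  define S where "S = (\<Sum>i<n. \<Sum>x\<in>F. cnj (w i x) * z i x)"
  have "(\<Sum>a<n. \<Sum>b<n. \<Sum>x\<in>F. \<Sum>y\<in>F. cnj (w a x) * outer (z a) (z b) x y * w b y)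
      = (\<Sum>a<n. \<Sum>b<n. (\<Sum>x\<in>F. cnj (w a x) * z a x) * cnj (\<Sum>y\<in>F. cnj (w b y) * z b y))"
    unfolding cnj_sum sum_product by (simp add: outer_def mult_ac)
  also have "\<dots> = S * cnj S" unfolding S_def cnj_sum sum_product ..
  finally show "cnonneg (\<Sum>a<n. \<Sum>b<n. \<Sum>x\<in>F. \<Sum>y\<in>F. cnj (w a x) * outer (z a) (z b) x y * w b y)"
    by (simp only: cnonneg_norm_square)
qed

lemma psd_op_outer: "psd_op (outer z z)"
  using psd_block_outer[of 1 "\<lambda>_. z"] unfolding psd_block_def psd_op_def
  by (intro allI impI) (drule spec, drule spec[of _ "\<lambda>_. _"], auto)

text \<open>A form in two variables that is nonnegative for every \<open>t\<close>: the values at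
  \<open>1\<close> and \<open>\<i>\<close> make it Hermitian, and minimising over \<open>t\<close>
  gives the Cauchy-Schwarz bound.\<close>

lemma psd2_cauchy:
  assumes psd: "\<And>t. cnonneg (P + t * B + cnj t * B' + cnj t * t * N)"
    and P: "cnonneg P" and N: "cnonneg N"
  shows "B' = cnj B" "(cmod B)^2 \<le> Re P * Re N"
proof -
  show herm: "B' = cnj B"
    using psd[of 1] psd[of \<i>] P N by (auto simp: cnonneg_def complex_eq_iff)
  have re: "0 \<le> Re P + 2 * Re (t * B) + (cmod t)^2 * Re N" for t
  proof -
    have "Re (cnj t * t * N) = (cmod t)^2 * Re N"
    proof -
      have "Re (of_real r * N) = r * Re N" for r by simp
      moreover have "cnj t * t = of_real ((cmod t)^2)" by (metis complex_norm_square mult.commute)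
      ultimately show ?thesis by (simp only:)
    qed
    moreover have "Re (cnj t * cnj B) = Re (t * B)" by simp
    ultimately show ?thesis using psd[of t] unfolding herm cnonneg_def plus_complex.sel by linarith
  qed
  show "(cmod B)^2 \<le> Re P * Re N"
  proof (cases "Re N = 0")
    case False
    then have N0: "0 < Re N" using N by (simp add: cnonneg_def)
    define t where "t = - cnj B / of_real (Re N)"
    have "t * B = - of_real ((cmod B)^2 / Re N)"
      using complex_norm_square[of B] by (simp add: t_def mult.commute[of "cnj B"])
    then have "Re (t * B) = - ((cmod B)^2 / Re N)" by simp
    moreover have "(cmod t)^2 * Re N = (cmod B)^2 / Re N"
      using N0 by (simp add: t_def norm_divide power_divide power2_eq_square)
    ultimately have "(cmod B)^2 / Re N \<le> Re P" using re[of t] by simp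
    then show ?thesis using N0 by (simp add: divide_le_eq)
  next
    case True
    have "(cmod B)^2 \<le> 0"
    proof (rule ccontr)
      assume "\<not> (cmod B)^2 \<le> 0"
      then have b: "0 < (cmod B)^2" by simp
      \<comment> \<open>Chosen so that the form would take the value -1.\<close>
      define r where "r = (Re P + 1) / (2 * (cmod B)^2)"
      have "(- of_real r * cnj B) * B = - of_real (r * (cmod B)^2)"
        by (simp only: of_real_mult complex_norm_square) (simp add: mult_ac)
      then have "Re ((- of_real r * cnj B) * B) = - (r * (cmod B)^2)"
        by (simp only: uminus_complex.sel Re_complex_of_real)
      also have "r * (cmod B)^2 = (Re P + 1) / 2" using b by (simp add: r_def)
      finally show False using re[of "- of_real r * cnj B"] True by simp
    qed
    then show ?thesis using True by simp
  qed
qed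

text \<open>By Cauchy-Schwarz an isotropic vector of a positive semidefinite form lies in its
  kernel.\<close>

lemma psd_matrix_null:
  fixes G :: "nat \<Rightarrow> nat \<Rightarrow> complex"
  assumes psd: "\<And>c. cnonneg (\<Sum>i<n. \<Sum>j<n. cnj (c i) * G i j * c j)"
    and null: "(\<Sum>i<n. \<Sum>j<n. cnj (u i) * G i j * u j) = 0"
  shows "(\<Sum>i<n. \<Sum>j<n. cnj (w i) * G i j * u j) = 0"
proof -
  define Q where "Q = (\<lambda>f g. \<Sum>i<n. \<Sum>j<n. cnj (f i) * G i j * g j)"
  have "Q (\<lambda>i. w i + t * u i) (\<lambda>i. w i + t * u i) = Q w w + t * Q w u + cnj t * Q u w + cnj t * t * Q u u" for t
    unfolding Q_def sum_distrib_left sum.distrib[symmetric]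
    by (intro sum.cong refl) (simp add: algebra_simps)
  then have "cnonneg (Q w w + t * Q w u + cnj t * Q u w + cnj t * t * Q u u)" for t
    using psd[of "\<lambda>i. w i + t * u i"] by (simp add: Q_def)
  then have "(cmod (Q w u))^2 \<le> Re (Q w w) * Re (Q u u)"
    by (rule psd2_cauchy(2)) (use psd in \<open>auto simp: Q_def\<close>)
  then show ?thesis using null by (simp add: Q_def)
qed

definition sesq :: "opr \<Rightarrow> nat \<Rightarrow> (nat \<Rightarrow> complex) \<Rightarrow> nat \<Rightarrow> (nat \<Rightarrow> complex) \<Rightarrow> complex" where
  "sesq X a v b w = (\<Sum>i\<le>a. \<Sum>j\<le>b. cnj (v i) * X (a, i) (b, j) * w j)"

lemma sesq_delta:
  assumes "i \<le> a" "j \<le> b"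
  shows "sesq X a (\<lambda>k. if k = i then 1 else 0) b (\<lambda>k. if k = j then 1 else 0) = X (a, i) (b, j)"
proof -
  have "sesq X a (\<lambda>k. if k = i then 1 else 0) b (\<lambda>k. if k = j then 1 else 0)
      = (\<Sum>k\<le>a. if k = i then (\<Sum>l\<le>b. if l = j then X (a, i) (b, j) else 0) else 0)"
    unfolding sesq_def using assms by (intro sum.cong refl) (simp add: sum_mult_delta)
  then show ?thesis using assms by simp
qed

lemma sesq_diff_left: "sesq X a (\<lambda>k. v k - c * v' k) b w = sesq X a v b w - cnj c * sesq X a v' b w"
  unfolding sesq_def sum_distrib_left sum_subtractf[symmetric]
  by (intro sum.cong refl) (simp add: algebra_simps)

lemma sesq_diff_right: "sesq X a v b (\<lambda>k. w k - c * w' k) = sesq X a v b w - c * sesq X a v b w'"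
  unfolding sesq_def sum_distrib_left sum_subtractf[symmetric]
  by (intro sum.cong refl) (simp add: algebra_simps)

lemma sesq_sum_right:
  "sesq X a v b w = (\<Sum>j\<le>b. w j * sesq X a v b (\<lambda>k. if k = j then 1 else 0))"
proof -
  have "sesq X a v b (\<lambda>k. if k = j then 1 else 0) = (\<Sum>i\<le>a. cnj (v i) * X (a, i) (b, j))" if "j \<le> b" for j
    unfolding sesq_def using that by (simp add: sum_mult_delta)
  then have "(\<Sum>j\<le>b. w j * sesq X a v b (\<lambda>k. if k = j then 1 else 0)) = (\<Sum>j\<le>b. w j * (\<Sum>i\<le>a. cnj (v i) * X (a, i) (b, j)))"
    by simp
  also have "\<dots> = (\<Sum>j\<le>b. \<Sum>i\<le>a. cnj (v i) * X (a, i) (b, j) * w j)"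
    by (simp only: sum_distrib_left mult_ac)
  finally show ?thesis unfolding sesq_def by (subst sum.swap) simp
qed

lemma sesq_sum_left:
  "sesq X a v b w = (\<Sum>i\<le>a. cnj (v i) * sesq X a (\<lambda>k. if k = i then 1 else 0) b w)"
proof -
  have "sesq X a (\<lambda>k. if k = i then 1 else 0) b w = (\<Sum>j\<le>b. X (a, i) (b, j) * w j)" if "i \<le> a" for i
  proof -
    have "sesq X a (\<lambda>k. if k = i then 1 else 0) b w = (\<Sum>k\<le>a. if k = i then (\<Sum>j\<le>b. X (a, i) (b, j) * w j) else 0)"
      unfolding sesq_def by (intro sum.cong refl) auto
    then show ?thesis using that by simp
  qed
  then show ?thesis unfolding sesq_def by (simp add: sum_distrib_left mult.assoc)
qed

lemma sesq_conj_op: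
  "sesq (conj_op (Trep t1 t2 t3) X) a v b w
    = sesq X a (\<lambda>i. \<Sum>k\<le>a. cnj (spin_rep t1 t2 t3 a k i) * v k) b (\<lambda>j. \<Sum>k\<le>b. cnj (spin_rep t1 t2 t3 b k j) * w k)"
proof -
  let ?S = "spin_rep t1 t2 t3"
  have "sesq (conj_op (Trep t1 t2 t3) X) a v b w
      = (\<Sum>k\<le>a. \<Sum>l\<le>b. \<Sum>i\<le>a. \<Sum>j\<le>b. cnj (v k) * (?S a k i * X (a, i) (b, j) * cnj (?S b l j)) * w l)"
    unfolding sesq_def by (intro sum.cong refl) (simp add: conj_op_Trep sum_distrib_left sum_distrib_right)
  also have "\<dots> = (\<Sum>k\<le>a. \<Sum>i\<le>a. \<Sum>j\<le>b. \<Sum>l\<le>b. cnj (v k) * (?S a k i * X (a, i) (b, j) * cnj (?S b l j)) * w l)"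
    by (rule sum.cong[OF refl], subst sum.swap, rule sum.cong[OF refl], rule sum.swap)
  also have "\<dots> = (\<Sum>i\<le>a. \<Sum>j\<le>b. \<Sum>k\<le>a. \<Sum>l\<le>b. cnj (v k) * (?S a k i * X (a, i) (b, j) * cnj (?S b l j)) * w l)"
    by (subst sum.swap, rule sum.cong[OF refl], rule sum.swap)
  also have "\<dots> = sesq X a (\<lambda>i. \<Sum>k\<le>a. cnj (?S a k i) * v k) b (\<lambda>j. \<Sum>k\<le>b. cnj (?S b k j) * w k)"
    unfolding sesq_def by (intro sum.cong refl) (simp add: sum_distrib_left sum_distrib_right mult_ac)
  finally show ?thesis .
qed

lemma sesq_outer:
  "sesq (\<lambda>x y. c * outer \<phi> \<phi> x y) a v b w = c * (\<Sum>i\<le>a. cnj (v i) * \<phi> (a, i)) * cnj (\<Sum>j\<le>b. cnj (w j) * \<phi> (b, j))"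
proof -
  have "c * (\<Sum>i\<le>a. cnj (v i) * \<phi> (a, i)) * cnj (\<Sum>j\<le>b. cnj (w j) * \<phi> (b, j))
      = c * (\<Sum>i\<le>a. \<Sum>j\<le>b. (cnj (v i) * \<phi> (a, i)) * cnj (cnj (w j) * \<phi> (b, j)))"
    by (simp only: cnj_sum mult.assoc[of c] sum_product)
  also have "\<dots> = sesq (\<lambda>x y. c * outer \<phi> \<phi> x y) a v b w"
    unfolding sum_distrib_left sesq_def by (intro sum.cong refl) (simp add: outer_def mult_ac)
  finally show ?thesis ..
qed

lemma conj_op_block_trace:
  "(\<Sum>k\<le>a. conj_op (Trep t1 t2 t3) X (a, k) (a, k)) = (\<Sum>k\<le>a. X (a, k) (a, k))"
proof -
  let ?S = "spin_rep t1 t2 t3 a"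
  have "(\<Sum>k\<le>a. conj_op (Trep t1 t2 t3) X (a, k) (a, k))
      = (\<Sum>k\<le>a. \<Sum>i\<le>a. \<Sum>j\<le>a. X (a, i) (a, j) * (cnj (?S k j) * ?S k i))"
    by (intro sum.cong refl) (simp add: conj_op_Trep mult_ac)
  also have "\<dots> = (\<Sum>i\<le>a. \<Sum>j\<le>a. \<Sum>k\<le>a. X (a, i) (a, j) * (cnj (?S k j) * ?S k i))"
    by (subst sum.swap, rule sum.cong[OF refl], rule sum.swap)
  also have "\<dots> = (\<Sum>i\<le>a. \<Sum>j\<le>a. X (a, i) (a, j) * (if j = i then 1 else 0))"
    by (intro sum.cong[OF refl]) (simp only: sum_distrib_left[symmetric] spin_rep_unitary atMost_iff)
  also have "\<dots> = (\<Sum>i\<le>a. X (a, i) (a, i))"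
    by (simp add: sum_mult_delta)
  finally show ?thesis .
qed

text \<open>The parameter \<open>pi / (m - n)\<close> makes the two phases opposite, so weights are
  compared without differentiating in \<open>t\<close>.\<close>

lemma phase_eq_zero:
  assumes "\<And>t. exp (\<i> * of_real t * of_real m) * z = exp (\<i> * of_real t * of_real n) * z" "m \<noteq> n"
  shows "z = 0"
proof -
  define t where "t = pi / (m - n)"
  have "t * m = t * n + pi" using assms(2) by (simp add: t_def field_simps)
  then have "complex_of_real t * of_real m = of_real t * of_real n + of_real pi"
    by (metis of_real_add of_real_mult)
  then have "exp (\<i> * of_real t * of_real m) = - exp (\<i> * of_real t * of_real n)"
    by (simp add: mult.assoc distrib_left exp_add exp_pi_i')
  then have "- (exp (\<i> * of_real t * of_real n) * z) = exp (\<i> * of_real t * of_real n) * z"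
    using assms(1)[of t] by simp
  then show ?thesis by simp
qed

lemma cnj_exp_phase: "cnj (exp (\<i> * of_real t * of_real u)) = exp (- (\<i> * of_real t * of_real u))"
  by (simp add: exp_cnj)

lemma exp_phase_diff:
  "exp (\<i> * of_real t * of_real (u - v)) = exp (\<i> * of_real t * of_real u) * cnj (exp (\<i> * of_real t * of_real v))"
  unfolding cnj_exp_phase mult_exp_exp by (simp add: right_diff_distrib)

section \<open>Linear combinations of finite-rank operators\<close>

lemma l2vec_scale: "l2vec u \<Longrightarrow> l2vec (\<lambda>x. c * u x)"
  by (auto simp: l2vec_def norm_mult power_mult_distrib intro: summable_on_cmult_right)

lemma finite_rank_scale:
  assumes "finite_rank_op X"
  shows "finite_rank_op (\<lambda>x y. c * X x y)"
proof -
  obtain N :: nat and u w where "\<forall>i<N. l2vec (u i) \<and> l2vec (w i)" and "X = (\<lambda>x y. \<Sum>i<N. u i x * cnj (w i y))"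
    using assms unfolding finite_rank_op_def by blast
  then show ?thesis unfolding finite_rank_op_def
    by (intro exI[of _ N] exI[of _ "\<lambda>i x. c * u i x"] exI[of _ w]) (auto simp: l2vec_scale sum_distrib_left mult_ac)
qed

lemma finite_rank_add:
  assumes "finite_rank_op X" "finite_rank_op Y"
  shows "finite_rank_op (\<lambda>x y. X x y + Y x y)"
proof -
  obtain N :: nat and u w where X: "\<forall>i<N. l2vec (u i) \<and> l2vec (w i)" "X = (\<lambda>x y. \<Sum>i<N. u i x * cnj (w i y))"
    using assms(1) unfolding finite_rank_op_def by blast
  obtain M :: nat and u' w' where Y: "\<forall>i<M. l2vec (u' i) \<and> l2vec (w' i)" "Y = (\<lambda>x y. \<Sum>i<M. u' i x * cnj (w' i y))"
    using assms(2) unfolding finite_rank_op_def by blast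
  define U where "U = (\<lambda>i. if i < N then u i else u' (i - N))"
  define W where "W = (\<lambda>i. if i < N then w i else w' (i - N))"
  have "X x y + Y x y = (\<Sum>i<N + M. U i x * cnj (W i y))" for x y
  proof -
    have "(\<Sum>i<N + M. U i x * cnj (W i y)) = (\<Sum>i<N. U i x * cnj (W i y)) + (\<Sum>i<M. U (N + i) x * cnj (W (N + i) y))"
      by (induction M) (simp_all add: add.assoc)
    then show ?thesis unfolding X(2) Y(2) U_def W_def by simp
  qed
  moreover have "\<forall>i<N + M. l2vec (U i) \<and> l2vec (W i)"
    using X(1) Y(1) by (auto simp: U_def W_def)
  ultimately show ?thesis unfolding finite_rank_op_def by blast
qed

lemma finite_rank_zero: "finite_rank_op (\<lambda>x y. 0)"
  unfolding finite_rank_op_def by (intro exI[of _ 0]) auto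

lemma finite_rank_sum:
  assumes "finite I" "\<And>i. i \<in> I \<Longrightarrow> finite_rank_op (X i)"
  shows "finite_rank_op (\<lambda>x y. \<Sum>i\<in>I. c i * X i x y)"
  using assms
proof (induction I)
  case (insert i I)
  then have "finite_rank_op (\<lambda>x y. c i * X i x y + (\<Sum>i\<in>I. c i * X i x y))"
    using finite_rank_add[OF finite_rank_scale[of "X i" "c i"]] by blast
  then show ?case using insert by simp
qed (simp add: finite_rank_zero)

section \<open>Matrix units and rotations about the z axis\<close>

definition unit_vec :: "bas \<Rightarrow> vec" where
  "unit_vec p = (\<lambda>x. if x = p then 1 else 0)"

lemma unit_vec_l2:
  assumes "valid p"
  shows "l2vec (unit_vec p)"
proof -
  have "(\<lambda>x. (cmod (unit_vec p x))^2) summable_on UNIV \<longleftrightarrow> (\<lambda>x. (cmod (unit_vec p x))^2) summable_on {p}"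
    by (rule summable_on_cong_neutral) (auto simp: unit_vec_def)
  then show ?thesis using assms by (auto simp: l2vec_def unit_vec_def)
qed

lemma spin_rep_z:
  assumes "k \<le> d" "l \<le> d"
  shows "spin_rep 0 0 t d k l = (if k = l then exp (\<i> * of_real t * of_real (real d / 2 - real l)) else 0)"
proof -
  have d: "(\<Sum>j\<le>d. f j * (if j = l then 1 else 0)) = f l" for f :: "nat \<Rightarrow> complex"
    using assms(2) by (simp add: sum_mult_delta)
  have "(\<Sum>j\<le>d. spin_rep (t * 0) (t * 0) (t * 1) d k j * (if j = l then 1 else 0))
      = exp (\<i> * of_real t * of_real (real d / 2 - real l)) * (if k = l then 1 else 0)"
  proof (rule spin_rep_eigen(1)[OF _ assms(1)])
    fix i
    show "(\<Sum>j\<le>d. nJ 0 0 1 d i j * (if j = l then 1 else 0)) = of_real (real d / 2 - real l) * (if i = l then 1 else 0)"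
      unfolding d by (simp add: nJ_def Jz_def)
  qed
  then show ?thesis unfolding d by simp
qed

lemma conj_op_z:
  assumes "k \<le> d" "k' \<le> d'"
  shows "conj_op (Trep 0 0 t) X (d, k) (d', k')
    = exp (\<i> * of_real t * of_real ((real d / 2 - real k) - (real d' / 2 - real k'))) * X (d, k) (d', k')"
proof -
  have "conj_op (Trep 0 0 t) X (d, k) (d', k') = (\<Sum>i\<le>d. \<Sum>j\<le>d'.
      (if i = k then (if j = k' then exp (\<i> * of_real t * of_real (real d / 2 - real k)) * X (d, k) (d', k') * cnj (exp (\<i> * of_real t * of_real (real d' / 2 - real k'))) else 0) else 0))"
    using assms unfolding conj_op_Trep by (simp, intro sum.cong refl) (simp add: spin_rep_z)
  also have "\<dots> = (\<Sum>i\<le>d. if i = k then exp (\<i> * of_real t * of_real (real d / 2 - real k)) * X (d, k) (d', k') * cnj (exp (\<i> * of_real t * of_real (real d' / 2 - real k'))) else 0)"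
    using assms by (intro sum.cong refl) simp
  also have "\<dots> = exp (\<i> * of_real t * of_real (real d / 2 - real k)) * X (d, k) (d', k') * cnj (exp (\<i> * of_real t * of_real (real d' / 2 - real k')))"
    using assms by simp
  also have "\<dots> = exp (\<i> * of_real t * of_real ((real d / 2 - real k) - (real d' / 2 - real k'))) * X (d, k) (d', k')"
    unfolding exp_phase_diff by (simp only: mult_ac)
  finally show ?thesis .
qed

section \<open>Upper bound for invariant operations\<close>

locale invariant_on_axis =
  fixes E :: "opr \<Rightarrow> opr" and nx ny nz :: real and e :: "nat \<Rightarrow> nat \<Rightarrow> complex"
  assumes invariant: "su2_invariant_operation E"
    and e_norm: "\<forall>d. (\<Sum>k\<le>d. (cmod (e d k))^2) = 1"
    and e_eig: "\<forall>d. \<forall>k\<le>d. (\<Sum>l\<le>d. nJ nx ny nz d k l * e d l) = complex_of_real (real d / 2) * e d k"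
begin

lemmas E_axioms = invariant[unfolded su2_invariant_operation_def]

lemma E_add: "finite_rank_op X \<Longrightarrow> finite_rank_op Y \<Longrightarrow> E (\<lambda>x y. X x y + Y x y) = (\<lambda>x y. E X x y + E Y x y)"
  by (rule E_axioms[THEN conjunct2, THEN conjunct1, rule_format])

lemma E_scale: "finite_rank_op X \<Longrightarrow> E (\<lambda>x y. c * X x y) = (\<lambda>x y. c * E X x y)"
  by (rule E_axioms[THEN conjunct2, THEN conjunct2, THEN conjunct1, rule_format])

lemma E_psd: "\<forall>a<n. \<forall>b<n. finite_rank_op (M a b) \<Longrightarrow> psd_block n M \<Longrightarrow> psd_block n (\<lambda>a b. E (M a b))"
  by (rule E_axioms[THEN conjunct2, THEN conjunct2, THEN conjunct2, THEN conjunct1, THEN spec, THEN spec, THEN mp, THEN mp])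

lemma E_trace: "finite_rank_op X \<Longrightarrow> psd_op X \<Longrightarrow> finite F \<Longrightarrow> (\<Sum>x\<in>F. Re (E X x x)) \<le> Re (trace_op X)"
  by (rule E_axioms[THEN conjunct2, THEN conjunct2, THEN conjunct2, THEN conjunct2, THEN conjunct1, rule_format])

lemma E_covariant: "finite_rank_op X \<Longrightarrow> E (conj_op (Trep t1 t2 t3) X) = conj_op (Trep t1 t2 t3) (E X)"
  by (rule E_axioms[THEN conjunct2, THEN conjunct2, THEN conjunct2, THEN conjunct2, THEN conjunct2, rule_format])

lemma E_zero: "E (\<lambda>x y. 0) = (\<lambda>x y. 0)"
  using E_scale[of "\<lambda>x y. 0" 0] finite_rank_zero by simp

lemma E_sum:
  assumes "finite I" "\<And>i. i \<in> I \<Longrightarrow> finite_rank_op (X i)"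
  shows "E (\<lambda>x y. \<Sum>i\<in>I. c i * X i x y) = (\<lambda>x y. \<Sum>i\<in>I. c i * E (X i) x y)"
  using assms
proof (induction I)
  case (insert i I)
  then have "E (\<lambda>x y. c i * X i x y + (\<Sum>i\<in>I. c i * X i x y))
      = (\<lambda>x y. c i * E (X i) x y + (\<Sum>i\<in>I. c i * E (X i) x y))"
    using E_add[OF finite_rank_scale[of "X i" "c i"] finite_rank_sum[of I X c]] E_scale[of "X i" "c i"] by simp
  then show ?case using insert by simp
qed (simp add: E_zero)

text \<open>Complete positivity, not just positivity, is used: the operators
  \<open>outer (z i) (z j)\<close> form a positive block matrix, and its image is tested on vectors
  \<open>v i\<close> placed in possibly different output blocks \<open>a i\<close>.\<close>

lemma gram_psd:
  fixes n :: nat and z :: "nat \<Rightarrow> vec"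
  assumes z: "\<And>i. i < n \<Longrightarrow> l2vec (z i)"
  shows "cnonneg (\<Sum>i<n. \<Sum>j<n. cnj (c i) * sesq (E (outer (z i) (z j))) (a i) (v i) (a j) (v j) * c j)"
proof -
  have psd: "psd_block n (\<lambda>i j. E (outer (z i) (z j)))"
    using z by (intro E_psd psd_block_outer) (auto intro: outer_finite_rank)
  \<comment> \<open>The output blocks that occur. Since \<open>w i\<close> lives in block
    \<open>a i\<close> only, each sum over \<open>F\<close> collapses to one block.\<close>
  define F where "F = Sigma (a ` {..<n}) (\<lambda>d. {..d})"
  have F: "finite F" by (simp add: F_def)
  define w where "w = (\<lambda>i x. if fst x = a i then c i * v i (snd x) else 0)"
  have sumF: "(\<Sum>x\<in>F. f x) = (\<Sum>k\<le>a i. f (a i, k))"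
    if "i < n" "\<And>x. fst x \<noteq> a i \<Longrightarrow> f x = 0" for f :: "bas \<Rightarrow> complex" and i
  proof -
    have "(\<Sum>x\<in>F. f x) = (\<Sum>d\<in>a ` {..<n}. \<Sum>k\<le>d. f (d, k))"
      unfolding F_def by (rule sum_Sigma_pair) auto
    also have "\<dots> = (\<Sum>d\<in>a ` {..<n}. if d = a i then \<Sum>k\<le>a i. f (a i, k) else 0)"
      using that(2) by (intro sum.cong refl) (auto intro: sum.neutral)
    also have "\<dots> = (\<Sum>k\<le>a i. f (a i, k))" using that(1) by simp
    finally show ?thesis .
  qed
  have "(\<Sum>x\<in>F. \<Sum>y\<in>F. cnj (w i x) * E (outer (z i) (z j)) x y * w j y)
      = cnj (c i) * sesq (E (outer (z i) (z j))) (a i) (v i) (a j) (v j) * c j" if "i < n" "j < n" for i j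
  proof -
    have "(\<Sum>x\<in>F. \<Sum>y\<in>F. cnj (w i x) * E (outer (z i) (z j)) x y * w j y)
        = (\<Sum>k\<le>a i. \<Sum>y\<in>F. cnj (w i (a i, k)) * E (outer (z i) (z j)) (a i, k) y * w j y)"
      by (rule sumF[OF that(1)]) (simp add: w_def)
    also have "\<dots> = (\<Sum>k\<le>a i. \<Sum>l\<le>a j. cnj (w i (a i, k)) * E (outer (z i) (z j)) (a i, k) (a j, l) * w j (a j, l))"
      by (intro sum.cong[OF refl], rule sumF[OF that(2)]) (simp add: w_def)
    also have "\<dots> = cnj (c i) * sesq (E (outer (z i) (z j))) (a i) (v i) (a j) (v j) * c j"
      unfolding sesq_def sum_distrib_left sum_distrib_right by (simp add: w_def mult_ac)
    finally show ?thesis .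
  qed
  then have "(\<Sum>i<n. \<Sum>j<n. \<Sum>x\<in>F. \<Sum>y\<in>F. cnj (w i x) * E (outer (z i) (z j)) x y * w j y)
      = (\<Sum>i<n. \<Sum>j<n. cnj (c i) * sesq (E (outer (z i) (z j))) (a i) (v i) (a j) (v j) * c j)"
    by simp
  then show ?thesis using psd[unfolded psd_block_def, rule_format, OF F, of w] by (simp only:)
qed

lemma pair_cauchy:
  assumes "l2vec x" "l2vec y"
  shows "cnonneg (sesq (E (outer x x)) a v a v)"
    and "sesq (E (outer y x)) b w a v = cnj (sesq (E (outer x y)) a v b w)"
    and "(cmod (sesq (E (outer x y)) a v b w))^2 \<le> Re (sesq (E (outer x x)) a v a v) * Re (sesq (E (outer y y)) b w b w)"
proof -
  have one: "cnonneg (sesq (E (outer x x)) a v a v)" if "l2vec x" for x a v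
    using gram_psd[of 1 "\<lambda>_. x" "\<lambda>_. 1" "\<lambda>_. a" "\<lambda>_. v"] that by simp
  show "cnonneg (sesq (E (outer x x)) a v a v)" using one[OF assms(1)] .
  have "cnonneg (sesq (E (outer x x)) a v a v + t * sesq (E (outer x y)) a v b w
      + cnj t * sesq (E (outer y x)) b w a v + cnj t * t * sesq (E (outer y y)) b w b w)" for t
    using gram_psd[of 2 "\<lambda>i. if i = 0 then x else y" "\<lambda>i. if i = 0 then 1 else t" "\<lambda>i. if i = 0 then a else b" "\<lambda>i. if i = 0 then v else w"] assms
    by (simp add: numeral_2_eq_2 algebra_simps)
  note c = psd2_cauchy[OF this one[OF assms(1)] one[OF assms(2)]]
  show "sesq (E (outer y x)) b w a v = cnj (sesq (E (outer x y)) a v b w)"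
    by (rule c(1))
  show "(cmod (sesq (E (outer x y)) a v b w))^2 \<le> Re (sesq (E (outer x x)) a v a v) * Re (sesq (E (outer y y)) b w b w)"
    by (rule c(2))
qed

lemma diag_bound:
  assumes "l2vec x" "i \<le> a"
  shows "0 \<le> Re (E (outer x x) (a, i) (a, i))" "Re (E (outer x x) (a, i) (a, i)) \<le> Re (trace_op (outer x x))"
proof -
  show "0 \<le> Re (E (outer x x) (a, i) (a, i))"
    using pair_cauchy(1)[OF assms(1,1), where a=a and v="\<lambda>k. if k = i then 1 else 0"]
    by (simp only: sesq_delta[OF assms(2,2)] cnonneg_def)
  show "Re (E (outer x x) (a, i) (a, i)) \<le> Re (trace_op (outer x x))"
    using E_trace[OF outer_finite_rank[OF assms(1,1)] psd_op_outer, of "{(a, i)}"] by simp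
qed

lemma entry_bound:
  assumes "l2vec x" "l2vec y" "i \<le> a" "j \<le> b"
  shows "(cmod (E (outer x y) (a, i) (b, j)))^2 \<le> Re (E (outer x x) (a, i) (a, i)) * Re (E (outer y y) (b, j) (b, j))"
  using pair_cauchy(3)[OF assms(1,2), where a=a and v="\<lambda>k. if k = i then 1 else 0" and b=b and w="\<lambda>k. if k = j then 1 else 0"]
    assms(3,4) by (simp add: sesq_delta)

definition hw :: "nat \<Rightarrow> vec" where
  "hw d = block_vec e (\<lambda>d'. if d' = d then 1 else 0)"

lemma block_vec_l2': "summable (\<lambda>d. (cmod (s d))^2) \<Longrightarrow> l2vec (block_vec e s)"
  by (rule block_vec_l2[OF e_norm])

lemma hw_l2: "l2vec (hw d)"
  unfolding hw_def by (intro block_vec_l2' summable_finite[of "{d}"]) auto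

lemma hw_pair: "hw d (d', k) = (if d' = d \<and> k \<le> d then e d k else 0)"
  by (auto simp: hw_def block_vec_pair)

text \<open>The continuity that linearity alone does not give. By \<open>entry_bound\<close> the
  error of a partial sum is controlled by a diagonal output entry of the tail, hence by the trace of
  the tail, which tends to 0.\<close>

lemma entry_sums:
  assumes x: "l2vec x" and s: "summable (\<lambda>d. (cmod (s d))^2)" and ij: "i \<le> a" "j \<le> b"
  shows "(\<lambda>d. cnj (s d) * E (outer x (hw d)) (a, i) (b, j)) sums E (outer x (block_vec e s)) (a, i) (b, j)"
proof -
  define N where "N = (\<Sum>d. (cmod (s d))^2)"
  have sN: "(\<lambda>d. (cmod (s d))^2) sums N" using s by (simp add: N_def summable_sums)
  define tail where "tail = (\<lambda>n d. if d < n then 0 else s d)"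
  have tail_sums: "(\<lambda>d. (cmod (tail n d))^2) sums (N - (\<Sum>d<n. (cmod (s d))^2))" for n
  proof -
    have "(\<lambda>d. if d \<in> {..<n} then (cmod (s d))^2 else 0) sums (\<Sum>d<n. (cmod (s d))^2)"
      by (rule sums_If_finite_set) simp
    from sums_diff[OF sN this] show ?thesis
      by (rule sums_cong[THEN iffD1, rotated]) (auto simp: tail_def)
  qed
  have l2: "l2vec (block_vec e (tail n))" for n
    using tail_sums by (intro block_vec_l2') (auto simp: sums_iff)
  have split: "E (outer x (block_vec e s)) (a, i) (b, j)
      = (\<Sum>d<n. cnj (s d) * E (outer x (hw d)) (a, i) (b, j)) + E (outer x (block_vec e (tail n))) (a, i) (b, j)" for n
  proof -
    have "outer x (block_vec e s) = (\<lambda>p q. (\<Sum>d<n. cnj (s d) * outer x (hw d) p q) + outer x (block_vec e (tail n)) p q)"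
    proof (intro ext)
      fix p q :: bas
      obtain d k where q: "q = (d, k)" by (cases q)
      have "(\<Sum>d'<n. cnj (s d') * outer x (hw d') p q) = (\<Sum>d'<n. if d' = d then cnj (s d) * outer x (hw d) p q else 0)"
        unfolding q outer_def by (intro sum.cong refl) (auto simp: hw_pair)
      then show "outer x (block_vec e s) p q = (\<Sum>d<n. cnj (s d) * outer x (hw d) p q) + outer x (block_vec e (tail n)) p q"
        unfolding q outer_def by (simp add: block_vec_pair tail_def hw_pair)
    qed
    moreover have "E (\<lambda>p q. (\<Sum>d<n. cnj (s d) * outer x (hw d) p q) + outer x (block_vec e (tail n)) p q)
        = (\<lambda>p q. (\<Sum>d<n. cnj (s d) * E (outer x (hw d)) p q) + E (outer x (block_vec e (tail n))) p q)"
      using E_add[OF finite_rank_sum[of "{..<n}" "\<lambda>d. outer x (hw d)" "\<lambda>d. cnj (s d)"] outer_finite_rank[OF x l2]]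
        E_sum[of "{..<n}" "\<lambda>d. outer x (hw d)" "\<lambda>d. cnj (s d)"] outer_finite_rank[OF x hw_l2] by simp
    ultimately show ?thesis by simp
  qed
  define C where "C = Re (E (outer x x) (a, i) (a, i))"
  have bound: "cmod ((\<Sum>d<n. cnj (s d) * E (outer x (hw d)) (a, i) (b, j)) - E (outer x (block_vec e s)) (a, i) (b, j))
      \<le> sqrt (C * (N - (\<Sum>d<n. (cmod (s d))^2)))" for n
  proof -
    have "cmod ((\<Sum>d<n. cnj (s d) * E (outer x (hw d)) (a, i) (b, j)) - E (outer x (block_vec e s)) (a, i) (b, j))
        = cmod (E (outer x (block_vec e (tail n))) (a, i) (b, j))"
      unfolding split[of n] by simp
    moreover have "(cmod (E (outer x (block_vec e (tail n))) (a, i) (b, j)))^2 \<le> C * (N - (\<Sum>d<n. (cmod (s d))^2))"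
    proof -
      have "(cmod (E (outer x (block_vec e (tail n))) (a, i) (b, j)))^2
          \<le> C * Re (E (outer (block_vec e (tail n)) (block_vec e (tail n))) (b, j) (b, j))"
        unfolding C_def by (rule entry_bound[OF x l2 ij])
      also have "\<dots> \<le> C * Re (trace_op (outer (block_vec e (tail n)) (block_vec e (tail n))))"
        unfolding C_def by (intro mult_left_mono diag_bound l2 x ij)
      finally show ?thesis by (simp add: block_vec_trace[OF e_norm tail_sums])
    qed
    ultimately show ?thesis by (simp add: real_le_rsqrt)
  qed
  have "(\<lambda>n. \<Sum>d<n. (cmod (s d))^2) \<longlonglongrightarrow> N" using sN by (simp add: sums_def)
  then have "(\<lambda>n. sqrt (C * (N - (\<Sum>d<n. (cmod (s d))^2)))) \<longlonglongrightarrow> sqrt (C * (N - N))"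
    by (intro tendsto_intros)
  then have "(\<lambda>n. sqrt (C * (N - (\<Sum>d<n. (cmod (s d))^2)))) \<longlonglongrightarrow> 0" by simp
  then have "(\<lambda>n. (\<Sum>d<n. cnj (s d) * E (outer x (hw d)) (a, i) (b, j)) - E (outer x (block_vec e s)) (a, i) (b, j)) \<longlonglongrightarrow> 0"
    by (rule Lim_null_comparison[rotated]) (simp add: bound)
  then show ?thesis unfolding sums_def by (rule LIM_zero_cancel)
qed

lemma sesq_sums:
  assumes "l2vec x" "summable (\<lambda>d. (cmod (s d))^2)"
  shows "(\<lambda>d. cnj (s d) * sesq (E (outer x (hw d))) a v b w) sums sesq (E (outer x (block_vec e s))) a v b w"
proof -
  have "(\<lambda>d. \<Sum>i\<le>a. \<Sum>j\<le>b. cnj (v i) * (cnj (s d) * E (outer x (hw d)) (a, i) (b, j)) * w j)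
      sums sesq (E (outer x (block_vec e s))) a v b w"
    unfolding sesq_def by (intro sums_sum sums_mult sums_mult2 entry_sums assms) auto
  moreover have "cnj (s d) * sesq (E (outer x (hw d))) a v b w
      = (\<Sum>i\<le>a. \<Sum>j\<le>b. cnj (v i) * (cnj (s d) * E (outer x (hw d)) (a, i) (b, j)) * w j)" for d
    unfolding sesq_def sum_distrib_left by (simp only: mult_ac)
  ultimately show ?thesis by (simp only:)
qed

section \<open>Selection rules from covariance\<close>

lemma rotate_hw:
  "conj_op (Trep (t * nx) (t * ny) (t * nz)) (outer (hw d) (hw d'))
    = (\<lambda>x y. exp (\<i> * of_real t * of_real (real d / 2 - real d' / 2)) * outer (hw d) (hw d') x y)"
proof (intro ext)
  fix x y :: bas
  obtain a k b l where xy: "x = (a, k)" "y = (b, l)" by (cases x, cases y)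
  let ?S = "spin_rep (t * nx) (t * ny) (t * nz)"
  show "conj_op (Trep (t * nx) (t * ny) (t * nz)) (outer (hw d) (hw d')) x y
     = exp (\<i> * of_real t * of_real (real d / 2 - real d' / 2)) * outer (hw d) (hw d') x y"
  proof (cases "k \<le> a \<and> l \<le> b")
    case True
    have rot: "(\<Sum>i\<le>a. ?S a k i * hw d (a, i)) = exp (\<i> * of_real t * of_real (real d / 2)) * hw d (a, k)" if "k \<le> a" for a k d
    proof (cases "a = d")
      case True
      have "(\<Sum>i\<le>d. ?S d k i * hw d (d, i)) = (\<Sum>i\<le>d. ?S d k i * e d i)"
        by (intro sum.cong) (auto simp: hw_pair)
      then show ?thesis using spin_rep_eigen(1)[of d nx ny nz "e d" "of_real (real d / 2)" k t] e_eig that True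
        by (simp add: hw_pair)
    qed (simp add: hw_pair)
    have "conj_op (Trep (t * nx) (t * ny) (t * nz)) (outer (hw d) (hw d')) x y
        = (\<Sum>i\<le>a. ?S a k i * hw d (a, i)) * cnj (\<Sum>j\<le>b. ?S b l j * hw d' (b, j))"
      using True unfolding xy conj_op_Trep cnj_sum sum_product by (simp add: outer_def mult_ac)
    also have "\<dots> = (exp (\<i> * of_real t * of_real (real d / 2)) * cnj (exp (\<i> * of_real t * of_real (real d' / 2)))) * (hw d (a, k) * cnj (hw d' (b, l)))"
      using True by (simp only: rot complex_cnj_mult) (simp only: mult_ac)
    also have "exp (\<i> * of_real t * of_real (real d / 2)) * cnj (exp (\<i> * of_real t * of_real (real d' / 2)))
        = exp (\<i> * of_real t * of_real (real d / 2 - real d' / 2))"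
      by (rule exp_phase_diff[symmetric])
    finally show ?thesis unfolding xy outer_def .
  next
    case False
    then show ?thesis unfolding xy conj_op_Trep outer_def by (auto simp: hw_pair)
  qed
qed

lemma E_rotate_hw:
  "conj_op (Trep (t * nx) (t * ny) (t * nz)) (E (outer (hw d) (hw d')))
    = (\<lambda>x y. exp (\<i> * of_real t * of_real (real d / 2 - real d' / 2)) * E (outer (hw d) (hw d')) x y)"
proof -
  have fr: "finite_rank_op (outer (hw d) (hw d'))" by (intro outer_finite_rank hw_l2)
  show ?thesis unfolding E_covariant[OF fr, symmetric] rotate_hw by (rule E_scale[OF fr])
qed

lemma sesq_scale: "sesq (\<lambda>x y. c * X x y) a v b w = c * sesq X a v b w"
  unfolding sesq_def sum_distrib_left by (simp only: mult_ac)

lemma sesq_scale_vecs: "sesq X a (\<lambda>i. c * v i) b (\<lambda>j. c' * w j) = cnj c * c' * sesq X a v b w"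
  unfolding sesq_def sum_distrib_left by (simp add: mult_ac)

lemma sesq_cong: "(\<And>i. i \<le> a \<Longrightarrow> v i = v' i) \<Longrightarrow> (\<And>i. i \<le> b \<Longrightarrow> w i = w' i) \<Longrightarrow> sesq X a v b w = sesq X a v' b w'"
  unfolding sesq_def by (intro sum.cong refl) auto

text \<open>A rotation by \<open>t\<close> about the axis multiplies the input by a phase of
  frequency (d - d') / 2 and the tested pair by one of frequency (a - b) / 2.\<close>

lemma weight_selection:
  assumes "int d - int d' \<noteq> int a - int b"
  shows "sesq (E (outer (hw d) (hw d'))) a (e a) b (e b) = 0"
proof (rule phase_eq_zero[where m="real d / 2 - real d' / 2" and n="real a / 2 - real b / 2"])
  fix t
  let ?X = "E (outer (hw d) (hw d'))"
  have ev: "(\<Sum>k\<le>a. cnj (spin_rep (t * nx) (t * ny) (t * nz) a k i) * e a k) = exp (- (\<i> * of_real t * of_real (real a / 2))) * e a i" if "i \<le> a" for a i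
    by (rule spin_rep_eigen(2)[OF _ that]) (simp add: e_eig)
  have "exp (\<i> * of_real t * of_real (real d / 2 - real d' / 2)) * sesq ?X a (e a) b (e b)
      = sesq (conj_op (Trep (t * nx) (t * ny) (t * nz)) ?X) a (e a) b (e b)"
    unfolding E_rotate_hw sesq_scale ..
  also have "\<dots> = sesq ?X a (\<lambda>i. exp (- (\<i> * of_real t * of_real (real a / 2))) * e a i) b (\<lambda>i. exp (- (\<i> * of_real t * of_real (real b / 2))) * e b i)"
    unfolding sesq_conj_op by (intro sesq_cong ev)
  also have "\<dots> = exp (\<i> * of_real t * of_real (real a / 2 - real b / 2)) * sesq ?X a (e a) b (e b)"
    unfolding sesq_scale_vecs exp_phase_diff cnj_exp_phase[symmetric] complex_cnj_cnj ..
  finally show "exp (\<i> * of_real t * of_real (real d / 2 - real d' / 2)) * sesq ?X a (e a) b (e b)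
      = exp (\<i> * of_real t * of_real (real a / 2 - real b / 2)) * sesq ?X a (e a) b (e b)" .
next
  show "real d / 2 - real d' / 2 \<noteq> real a / 2 - real b / 2"
  proof
    assume "real d / 2 - real d' / 2 = real a / 2 - real b / 2"
    then have "real_of_int (int d - int d') = real_of_int (int a - int b)" by simp
    then show False using assms by (simp only: of_int_eq_iff)
  qed
qed

text \<open>The trace over an output block is invariant under rotations, so only inputs of weight
  difference 0 about the axis contribute.\<close>

lemma trace_selection:
  assumes "d \<noteq> d'"
  shows "(\<Sum>k\<le>a. E (outer (hw d) (hw d')) (a, k) (a, k)) = 0"
proof (rule phase_eq_zero[where m="real d / 2 - real d' / 2" and n=0])
  fix t
  show "exp (\<i> * of_real t * of_real (real d / 2 - real d' / 2)) * (\<Sum>k\<le>a. E (outer (hw d) (hw d')) (a, k) (a, k))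
      = exp (\<i> * of_real t * of_real 0) * (\<Sum>k\<le>a. E (outer (hw d) (hw d')) (a, k) (a, k))"
    using conj_op_block_trace[of "t * nx" "t * ny" "t * nz" "E (outer (hw d) (hw d'))" a]
    unfolding E_rotate_hw by (simp add: sum_distrib_left)
qed (use assms in simp)

text \<open>Weights about the z axis within block \<open>d\<close> differ by at most
  \<open>d\<close>, while the corner entry of block \<open>a\<close> connects weights differing by
  \<open>a\<close>.\<close>

lemma corner_zero:
  assumes "d < a" and u: "\<And>x. fst x \<noteq> d \<or> \<not> valid x \<Longrightarrow> u x = 0"
  shows "E (outer u u) (a, 0) (a, a) = 0"
proof -
  have basis: "E (outer (unit_vec (d, k)) (unit_vec (d, l))) (a, 0) (a, a) = 0" if kl: "k \<le> d" "l \<le> d" for k l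
  proof (rule phase_eq_zero[where m="real a" and n="real l - real k"])
    fix t
    let ?X = "outer (unit_vec (d, k)) (unit_vec (d, l))"
    have fr: "finite_rank_op ?X" using kl by (intro outer_finite_rank unit_vec_l2) (auto simp: valid_def)
    have "conj_op (Trep 0 0 t) ?X = (\<lambda>x y. exp (\<i> * of_real t * of_real (real l - real k)) * ?X x y)"
    proof (intro ext)
      fix x y :: bas
      obtain p i p' j where xy: "x = (p, i)" "y = (p', j)" by (cases x, cases y)
      show "conj_op (Trep 0 0 t) ?X x y = exp (\<i> * of_real t * of_real (real l - real k)) * ?X x y"
      proof (cases "i \<le> p \<and> j \<le> p'")
        case True
        then show ?thesis unfolding xy by (simp only: conj_op_z) (simp add: outer_def unit_vec_def)
      next
        case False
        then have "?X x y = 0" using kl unfolding xy by (auto simp: outer_def unit_vec_def)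
        then show ?thesis unfolding xy conj_op_Trep if_not_P[OF False] by simp
      qed
    qed
    then have "(\<lambda>x y. exp (\<i> * of_real t * of_real (real l - real k)) * E ?X x y) = conj_op (Trep 0 0 t) (E ?X)"
      using E_covariant[OF fr, of 0 0 t] by (simp only: E_scale[OF fr])
    then have "exp (\<i> * of_real t * of_real (real l - real k)) * E ?X (a, 0) (a, a) = conj_op (Trep 0 0 t) (E ?X) (a, 0) (a, a)"
      by (rule fun_cong[OF fun_cong])
    also have "\<dots> = exp (\<i> * of_real t * of_real (real a)) * E ?X (a, 0) (a, a)"
      by (simp add: conj_op_z)
    finally show "exp (\<i> * of_real t * of_real (real a)) * E ?X (a, 0) (a, a)
        = exp (\<i> * of_real t * of_real (real l - real k)) * E ?X (a, 0) (a, a)" ..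
  next
    have "real l - real k < real a" using kl assms(1) by linarith
    then show "real a \<noteq> real l - real k" by simp
  qed
  define I where "I = {..d} \<times> {..d}"
  let ?X = "\<lambda>i. outer (unit_vec (d, fst i)) (unit_vec (d, snd i))"
  let ?c = "\<lambda>i. u (d, fst i) * cnj (u (d, snd i))"
  have uexp: "u x = (\<Sum>k\<le>d. u (d, k) * unit_vec (d, k) x)" for x
  proof -
    obtain p i where x: "x = (p, i)" by (cases x)
    have "(\<Sum>k\<le>d. u (d, k) * unit_vec (d, k) x) = (\<Sum>k\<le>d. if k = i then (if p = d then u x else 0) else 0)"
      by (intro sum.cong) (auto simp: unit_vec_def x)
    then show ?thesis using u[of x] by (auto simp: x valid_def)
  qed
  have "outer u u = (\<lambda>x y. \<Sum>i\<in>I. ?c i * ?X i x y)"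
  proof (intro ext)
    fix x y :: bas
    have "outer u u x y = (\<Sum>k\<le>d. u (d, k) * unit_vec (d, k) x) * cnj (\<Sum>l\<le>d. u (d, l) * unit_vec (d, l) y)"
      unfolding outer_def by (simp only: uexp[symmetric])
    also have "\<dots> = (\<Sum>k\<le>d. \<Sum>l\<le>d. ?c (k, l) * ?X (k, l) x y)"
      unfolding cnj_sum sum_product by (simp add: outer_def mult_ac)
    finally show "outer u u x y = (\<Sum>i\<in>I. ?c i * ?X i x y)"
      unfolding I_def by (simp add: sum_Sigma_pair)
  qed
  moreover have "finite_rank_op (?X i)" if "i \<in> I" for i
    using that by (intro outer_finite_rank unit_vec_l2) (auto simp: I_def valid_def)
  ultimately have "E (outer u u) (a, 0) (a, a) = (\<Sum>i\<in>I. ?c i * E (?X i) (a, 0) (a, a))"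
    using E_sum[of I ?X ?c] by (simp add: I_def)
  also have "\<dots> = 0" by (intro sum.neutral) (auto simp: I_def basis)
  finally show ?thesis .
qed

lemma block_trace_le_one: "(\<Sum>i\<le>a. Re (E (outer (hw d) (hw d)) (a, i) (a, i))) \<le> 1"
proof -
  have "(\<lambda>d'. (cmod (if d' = d then 1 else 0))^2) sums 1"
    using sums_single[of d "\<lambda>_. 1 :: real"] by (rule sums_cong[THEN iffD1, rotated]) auto
  then have "trace_op (outer (hw d) (hw d)) = 1"
    unfolding hw_def by (simp add: block_vec_trace[OF e_norm])
  then show ?thesis
    using E_trace[OF outer_finite_rank[OF hw_l2 hw_l2] psd_op_outer, of "Pair a ` {..a}" d]
    by (simp add: sum.reindex inj_on_def)
qed

text \<open>The expectation of a positive block in a unit vector is at most its trace; positivity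
  enters through the bound of each entry by two diagonal ones.\<close>

lemma transition_le_one: "Re (sesq (E (outer (hw d) (hw d))) a (e a) a (e a)) \<le> 1"
proof -
  define g where "g = (\<lambda>i. Re (E (outer (hw d) (hw d)) (a, i) (a, i)))"
  have g0: "0 \<le> g i" if "i \<le> a" for i
    unfolding g_def by (rule diag_bound(1)[OF hw_l2 that])
  have L: "cmod (E (outer (hw d) (hw d)) (a, i) (a, j)) \<le> sqrt (g i) * sqrt (g j)" if "i \<le> a" "j \<le> a" for i j
    unfolding real_sqrt_mult[symmetric] g_def by (rule real_le_rsqrt, rule entry_bound[OF hw_l2 hw_l2 that])
  have "Re (sesq (E (outer (hw d) (hw d))) a (e a) a (e a)) \<le> cmod (sesq (E (outer (hw d) (hw d))) a (e a) a (e a))"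
    by (rule complex_Re_le_cmod)
  also have "\<dots> \<le> (\<Sum>i\<le>a. \<Sum>j\<le>a. cmod (cnj (e a i) * E (outer (hw d) (hw d)) (a, i) (a, j) * e a j))"
    unfolding sesq_def by (intro order_trans[OF norm_sum] sum_mono) auto
  also have "\<dots> \<le> (\<Sum>i\<le>a. \<Sum>j\<le>a. (cmod (e a i) * sqrt (g i)) * (cmod (e a j) * sqrt (g j)))"
  proof (intro sum_mono)
    fix i j assume ij: "i \<in> {..a}" "j \<in> {..a}"
    have "cmod (e a i) * cmod (E (outer (hw d) (hw d)) (a, i) (a, j)) * cmod (e a j)
        \<le> cmod (e a i) * (sqrt (g i) * sqrt (g j)) * cmod (e a j)"
      using L[of i j] ij by (intro mult_right_mono mult_left_mono) auto
    then show "cmod (cnj (e a i) * E (outer (hw d) (hw d)) (a, i) (a, j) * e a j)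
        \<le> (cmod (e a i) * sqrt (g i)) * (cmod (e a j) * sqrt (g j))"
      by (simp add: norm_mult mult_ac)
  qed
  also have "\<dots> = (\<Sum>i\<le>a. cmod (e a i) * sqrt (g i))^2"
    unfolding power2_eq_square sum_product ..
  also have "\<dots> \<le> (\<Sum>i\<le>a. (cmod (e a i))^2) * (\<Sum>i\<le>a. (sqrt (g i))^2)"
    by (rule Cauchy_Schwarz_ineq_sum)
  also have "\<dots> = (\<Sum>i\<le>a. g i)" using e_norm g0 by simp
  also have "\<dots> \<le> 1" unfolding g_def by (rule block_trace_le_one)
  finally show ?thesis .
qed

section \<open>The complement of the highest weight vector in a block\<close>

lemma block_vec_inner:
  "(\<Sum>i\<le>a. cnj (v i) * block_vec e t (a, i)) = t a * (\<Sum>i\<le>a. cnj (v i) * e a i)"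
  unfolding sum_distrib_left by (intro sum.cong refl) (simp add: block_vec_pair)

lemma e_inner: "(\<Sum>i\<le>a. cnj (e a i) * e a i) = 1"
proof -
  have "(\<Sum>i\<le>a. cnj (e a i) * e a i) = of_real (\<Sum>i\<le>a. (cmod (e a i))^2)"
    by (simp only: of_real_sum complex_norm_square mult.commute)
  then show ?thesis using e_norm by simp
qed

text \<open>The projection of basis vector \<open>k\<close> onto the orthogonal complement of
  \<open>e a\<close>.\<close>

definition off_axis :: "nat \<Rightarrow> nat \<Rightarrow> nat \<Rightarrow> complex" where
  "off_axis a k i = (if i = k then 1 else 0) - cnj (e a k) * e a i"

lemma off_axis_inner:
  assumes "k \<le> a"
  shows "(\<Sum>i\<le>a. cnj (off_axis a k i) * e a i) = 0"
proof -
  have "(\<Sum>i\<le>a. cnj (off_axis a k i) * e a i) = (\<Sum>i\<le>a. e a i * (if i = k then 1 else 0)) - e a k * (\<Sum>i\<le>a. cnj (e a i) * e a i)"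
    unfolding sum_distrib_left sum_subtractf[symmetric]
    by (intro sum.cong refl) (auto simp: off_axis_def algebra_simps)
  then show ?thesis using assms by (simp add: e_inner sum_mult_delta)
qed

text \<open>Expresses the trace over the complement of \<open>e a\<close> by two quantities that
  both obey selection rules.\<close>

lemma off_axis_trace:
  "(\<Sum>k\<le>a. sesq X a (off_axis a k) a (off_axis a k)) = (\<Sum>k\<le>a. X (a, k) (a, k)) - sesq X a (e a) a (e a)"
proof -
  let ?\<delta> = "\<lambda>k i. if i = k then 1 else (0::complex)"
  have "sesq X a (off_axis a k) a (off_axis a k)
      = X (a, k) (a, k) - cnj (e a k) * sesq X a (?\<delta> k) a (e a) - e a k * sesq X a (e a) a (?\<delta> k)
        + (cnj (e a k) * e a k) * sesq X a (e a) a (e a)" if "k \<le> a" for k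
    unfolding off_axis_def[abs_def] sesq_diff_left sesq_diff_right sesq_delta[OF that that]
    by (simp add: algebra_simps)
  then have "(\<Sum>k\<le>a. sesq X a (off_axis a k) a (off_axis a k))
      = (\<Sum>k\<le>a. X (a, k) (a, k)) - (\<Sum>k\<le>a. cnj (e a k) * sesq X a (?\<delta> k) a (e a))
        - (\<Sum>k\<le>a. e a k * sesq X a (e a) a (?\<delta> k)) + (\<Sum>k\<le>a. cnj (e a k) * e a k) * sesq X a (e a) a (e a)"
    by (simp add: sum.distrib sum_subtractf sum_distrib_right)
  then show ?thesis
    unfolding sesq_sum_left[symmetric] sesq_sum_right[symmetric] e_inner by simp
qed

text \<open>An output in the highest weight space forces every input component to be mapped, within
  block \<open>a\<close>, to a multiple of \<open>e a\<close>. Rotating by a generic group element would then create the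
  coherence between the extreme weights of block \<open>a\<close>, which a smaller spin \<open>d / 2\<close> cannot supply.\<close>

lemma no_raising:
  assumes s: "summable (\<lambda>d. (cmod (s d))^2)"
    and out: "E (outer (block_vec e s) (block_vec e s)) = (\<lambda>x y. lam * outer (block_vec e t) (block_vec e t) x y)"
    and coh: "\<alpha> \<noteq> 0 \<or> \<beta> \<noteq> 0" "\<exists>c. cmod c = 1 \<and> (\<forall>k\<le>a. e a k = c * coherent \<alpha> \<beta> a k)"
    and "s d \<noteq> 0" "d < a"
  shows "sesq (E (outer (hw d) (hw d))) a (e a) a (e a) = 0"
proof -
  let ?\<psi> = "block_vec e s"
  define L where "L = E (outer (hw d) (hw d))"
  note l2 = block_vec_l2'[OF s]
  \<comment> \<open>In block \<open>a\<close> the output for the full input lives on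
    \<open>e a\<close> alone; Cauchy-Schwarz extends this to mixed outputs with the full input on
    one side.\<close>
  have orth: "sesq (E (outer (hw d) ?\<psi>)) a (off_axis a k) a (off_axis a k) = 0" if "k \<le> a" for k
  proof -
    have "sesq (E (outer ?\<psi> ?\<psi>)) a (off_axis a k) a (off_axis a k) = 0"
      unfolding out sesq_outer block_vec_inner off_axis_inner[OF that] by simp
    then show ?thesis
      using pair_cauchy(3)[OF hw_l2 l2, of d a "off_axis a k" a "off_axis a k"] by simp
  qed
  define C where "C = cnj (s d) * (\<Sum>k\<le>a. sesq L a (off_axis a k) a (off_axis a k))"
  \<comment> \<open>The sum over \<open>k\<close> isolates \<open>d' = d\<close>: for other
    \<open>d'\<close> the selection rules kill the total over the complement, though not obviously
    each term.\<close>
  have "(\<lambda>d'. \<Sum>k\<le>a. cnj (s d') * sesq (E (outer (hw d) (hw d'))) a (off_axis a k) a (off_axis a k)) sums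
     (\<Sum>k\<le>a. sesq (E (outer (hw d) ?\<psi>)) a (off_axis a k) a (off_axis a k))"
    by (intro sums_sum sesq_sums hw_l2 s)
  also have "(\<Sum>k\<le>a. sesq (E (outer (hw d) ?\<psi>)) a (off_axis a k) a (off_axis a k)) = 0"
    using orth by simp
  also have "(\<lambda>d'. \<Sum>k\<le>a. cnj (s d') * sesq (E (outer (hw d) (hw d'))) a (off_axis a k) a (off_axis a k))
      = (\<lambda>d'. if d' = d then C else 0)"
  proof
    fix d'
    have "(\<Sum>k\<le>a. sesq (E (outer (hw d) (hw d'))) a (off_axis a k) a (off_axis a k)) = 0" if "d' \<noteq> d"
      unfolding off_axis_trace using trace_selection[of d d' a] weight_selection[of d d' a a] that by simp
    then show "(\<Sum>k\<le>a. cnj (s d') * sesq (E (outer (hw d) (hw d'))) a (off_axis a k) a (off_axis a k))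
        = (if d' = d then C else 0)"
      unfolding sum_distrib_left[symmetric] by (auto simp: C_def L_def)
  qed
  finally have "C = 0"
    by (rule sums_unique2[OF sums_single[of d "\<lambda>_. C"]])
  then have sum0: "(\<Sum>k\<le>a. Re (sesq L a (off_axis a k) a (off_axis a k))) = 0"
    using \<open>s d \<noteq> 0\<close> unfolding C_def Re_sum[symmetric] by simp
  have off0: "Re (sesq L a (off_axis a k) a (off_axis a k)) = 0" if "k \<le> a" for k
  proof -
    have "\<forall>k\<in>{..a}. Re (sesq L a (off_axis a k) a (off_axis a k)) = 0"
      using sum0 pair_cauchy(1)[OF hw_l2 hw_l2]
      by (subst sum_nonneg_eq_0_iff[symmetric]) (auto simp: L_def cnonneg_def)
    then show ?thesis using that by simp
  qed
  define G where "G = sesq L a (e a) a (e a)"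
  let ?\<delta> = "\<lambda>k i. if i = k then 1 else (0::complex)"
  have left: "sesq L a (?\<delta> k) a w = e a k * sesq L a (e a) a w" if "k \<le> a" for k w
  proof -
    have "sesq L a (off_axis a k) a w = 0"
      using pair_cauchy(3)[OF hw_l2 hw_l2, of d d a "off_axis a k" a w] off0[OF that] by (simp add: L_def)
    then show ?thesis unfolding off_axis_def[abs_def] sesq_diff_left by simp
  qed
  have herm: "sesq L a v a w = cnj (sesq L a w a v)" for v w
    unfolding L_def by (rule pair_cauchy(2)[OF hw_l2 hw_l2])
  \<comment> \<open>Within block \<open>a\<close> the output for \<open>hw d\<close> is
    \<open>G\<close> times the projector onto \<open>e a\<close>.\<close>
  have entry: "L (a, i) (a, j) = e a i * G * cnj (e a j)" if "i \<le> a" "j \<le> a" for i j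
  proof -
    have "sesq L a (e a) a (?\<delta> j) = cnj (e a j * G)"
      using herm[of "e a" "?\<delta> j"] left[OF that(2), of "e a"] by (simp add: G_def)
    moreover have "cnj G = G" using herm[of "e a" "e a"] by (simp add: G_def)
    ultimately show ?thesis using left[OF that(1), of "?\<delta> j"] sesq_delta[OF that, of L] by (simp add: mult_ac)
  qed
  obtain t1 t2 t3 where gen: "(\<Sum>l\<le>1. spin_rep t1 t2 t3 1 0 l * coherent \<alpha> \<beta> 1 l) \<noteq> 0"
    "(\<Sum>l\<le>1. spin_rep t1 t2 t3 1 1 l * coherent \<alpha> \<beta> 1 l) \<noteq> 0"
    using ex_spin_rep_generic[OF coh(1)] by metis
  obtain c where c: "cmod c = 1" "\<forall>k\<le>a. e a k = c * coherent \<alpha> \<beta> a k" using coh(2) by blast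
  let ?S = "spin_rep t1 t2 t3"
  define f where "f = (\<lambda>k. \<Sum>i\<le>a. ?S a k i * e a i)"
  have fc: "f k = c * (\<Sum>i\<le>a. ?S a k i * coherent \<alpha> \<beta> a i)" for k
    unfolding f_def sum_distrib_left using c(2) by (intro sum.cong) auto
  have "c \<noteq> 0" using c(1) by auto
  then have f_ne: "f 0 \<noteq> 0" "f a \<noteq> 0"
    unfolding fc spin_rep_coherent_ends[where d=a] using gen by simp_all
  \<comment> \<open>The rotated \<open>hw d\<close>, still inside block \<open>d\<close>. Its output
    has vanishing corner by \<open>corner_zero\<close>, whereas \<open>entry\<close> evaluates that
    corner to \<open>G * (f 0 * cnj (f a))\<close>.\<close>
  define u where "u = (\<lambda>x. if valid x then \<Sum>i\<le>fst x. ?S (fst x) (snd x) i * hw d (fst x, i) else 0)"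
  have "outer u u = conj_op (Trep t1 t2 t3) (outer (hw d) (hw d))"
  proof (intro ext)
    fix x y :: bas
    obtain p k p' k' where xy: "x = (p, k)" "y = (p', k')" by (cases x, cases y)
    show "outer u u x y = conj_op (Trep t1 t2 t3) (outer (hw d) (hw d)) x y"
    proof (cases "k \<le> p \<and> k' \<le> p'")
      case True
      then have "outer u u x y = (\<Sum>i\<le>p. ?S p k i * hw d (p, i)) * cnj (\<Sum>j\<le>p'. ?S p' k' j * hw d (p', j))"
        by (simp add: outer_def u_def xy valid_def)
      also have "\<dots> = (\<Sum>i\<le>p. \<Sum>j\<le>p'. ?S p k i * outer (hw d) (hw d) (p, i) (p', j) * cnj (?S p' k' j))"
        unfolding cnj_sum sum_product by (simp add: outer_def mult_ac)
      finally show ?thesis using True unfolding xy conj_op_Trep by simp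
    next
      case False
      then show ?thesis unfolding xy conj_op_Trep if_not_P[OF False] by (auto simp: outer_def u_def valid_def)
    qed
  qed
  then have "conj_op (Trep t1 t2 t3) L (a, 0) (a, a) = E (outer u u) (a, 0) (a, a)"
    unfolding L_def E_covariant[OF outer_finite_rank[OF hw_l2 hw_l2], symmetric] by simp
  also have "\<dots> = 0"
    using \<open>d < a\<close> by (intro corner_zero) (auto simp: u_def hw_pair)
  finally have "0 = (\<Sum>i\<le>a. \<Sum>j\<le>a. ?S a 0 i * L (a, i) (a, j) * cnj (?S a a j))"
    unfolding conj_op_Trep by simp
  also have "\<dots> = (\<Sum>i\<le>a. \<Sum>j\<le>a. G * ((?S a 0 i * e a i) * cnj (?S a a j * e a j)))"
    by (intro sum.cong refl) (simp add: entry mult_ac)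
  also have "\<dots> = G * (f 0 * cnj (f a))"
    by (simp only: f_def cnj_sum sum_product) (simp only: sum_distrib_left)
  finally show ?thesis using f_ne by (simp add: G_def L_def)
qed

text \<open>Weight conservation leaves one block of the superposition, the \<open>d'\<close> with d
  - a = d' - b.\<close>

lemma hw_block_vec_sesq:
  assumes "summable (\<lambda>d. (cmod (s d))^2)" "int d + int b = int a + int d'"
  shows "sesq (E (outer (hw d) (block_vec e s))) a (e a) b (e b)
    = cnj (s d') * sesq (E (outer (hw d) (hw d'))) a (e a) b (e b)"
proof -
  let ?K = "\<lambda>d'. sesq (E (outer (hw d) (hw d'))) a (e a) b (e b)"
  have "(\<lambda>d'. cnj (s d') * ?K d') sums sesq (E (outer (hw d) (block_vec e s))) a (e a) b (e b)"
    by (rule sesq_sums[OF hw_l2 assms(1)])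
  also have "(\<lambda>d'. cnj (s d') * ?K d') = (\<lambda>x. if x = d' then cnj (s x) * ?K x else 0)"
    using assms(2) by (intro ext) (auto intro: weight_selection)
  finally show ?thesis by (rule sums_unique2[OF _ sums_single[of d' "\<lambda>x. cnj (s x) * ?K x"]])
qed

text \<open>A weight shift by \<open>d - a\<close> that misses part of the output spectrum has amplitude zero: the
  amplitudes out of the input are proportional to those of the output, so they vanish together.\<close>

lemma no_partial_shift:
  assumes s: "summable (\<lambda>d. (cmod (s d))^2)"
    and out: "E (outer (block_vec e s) (block_vec e s)) = (\<lambda>x y. lam * outer (block_vec e t) (block_vec e t) x y)"
    and b: "t b \<noteq> 0" "s (b + d - a) = 0" and d: "a \<le> d" "s d \<noteq> 0"
  shows "sesq (E (outer (hw d) (hw d))) a (e a) a (e a) = 0"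
proof -
  let ?\<psi> = "block_vec e s"
  note l2 = block_vec_l2'[OF s]
  \<comment> \<open>Three vectors enter the Gram matrix: the full input tested on \<open>e a\<close>
    and on \<open>e b\<close>, and its block \<open>d\<close> tested on \<open>e a\<close>.\<close>
  let ?z = "\<lambda>i::nat. if i = 2 then hw d else ?\<psi>"
  let ?a = "\<lambda>i::nat. if i = 1 then b else a"
  define G where "G = (\<lambda>i j. sesq (E (outer (?z i) (?z j))) (?a i) (e (?a i)) (?a j) (e (?a j)))"
  \<comment> \<open>On the first two vectors the Gram matrix has rank at most one, built from
    \<open>t a\<close> and \<open>t b\<close>; this combination is null for it.\<close>
  define u where "u = (\<lambda>i::nat. if i = 0 then cnj (t b) else if i = 1 then - cnj (t a) else 0)"
  have psd: "cnonneg (\<Sum>i<3. \<Sum>j<3. cnj (c i) * G i j * c j)" for c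
    unfolding G_def by (rule gram_psd) (simp add: l2 hw_l2)
  have out': "sesq (E (outer ?\<psi> ?\<psi>)) x (e x) y (e y) = lam * t x * cnj (t y)" for x y
    unfolding out sesq_outer block_vec_inner e_inner by simp
  have "(\<Sum>i<3. \<Sum>j<3. cnj (u i) * G i j * u j) = 0"
    by (simp add: numeral_3_eq_3 u_def G_def out' algebra_simps)
  \<comment> \<open>A null vector also annihilates the third row, which ties the amplitude into
    \<open>a\<close> to the one into \<open>b\<close>.\<close>
  from psd_matrix_null[OF psd this, of "\<lambda>i. if i = 2 then 1 else 0"]
  have "cnj (t b) * sesq (E (outer (hw d) ?\<psi>)) a (e a) a (e a) - cnj (t a) * sesq (E (outer (hw d) ?\<psi>)) a (e a) b (e b) = 0"
    by (simp add: numeral_3_eq_3 u_def G_def mult_ac)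
  \<comment> \<open>The shift reaches \<open>b\<close> only from block \<open>b + d - a\<close>,
    absent from the input; \<open>a \<le> d\<close> makes the truncated subtraction exact.\<close>
  moreover have "sesq (E (outer (hw d) ?\<psi>)) a (e a) b (e b) = 0"
    using hw_block_vec_sesq[OF s, of d b a "b + d - a"] b d by simp
  ultimately show ?thesis using hw_block_vec_sesq[OF s, of d a a d] b(1) d(2) by simp
qed

lemma achieved_le:
  assumes p: "\<forall>d. 0 \<le> p d" "summable p" and q: "\<forall>d. 0 \<le> q d"
    and out: "E (outer (hstate e p) (hstate e p)) = (\<lambda>x y. of_real lam * outer (hstate e q) (hstate e q) x y)"
    and coh: "\<alpha> \<noteq> 0 \<or> \<beta> \<noteq> 0" "\<And>d. \<exists>c. cmod c = 1 \<and> (\<forall>k\<le>d. e d k = c * coherent \<alpha> \<beta> d k)"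
    and unique: "\<And>M. M \<noteq> D \<Longrightarrow> \<exists>b. q b \<noteq> 0 \<and> p (b + M) = 0"
    and a: "q a \<noteq> 0"
  shows "lam * q a \<le> p (a + D)"
proof -
  define s where "s = (\<lambda>d. complex_of_real (sqrt (p d)))"
  define t where "t = (\<lambda>d. complex_of_real (sqrt (q d)))"
  have out: "E (outer (block_vec e s) (block_vec e s)) = (\<lambda>x y. of_real lam * outer (block_vec e t) (block_vec e t) x y)"
    using out unfolding hstate_eq_block_vec s_def t_def .
  have sp: "(cmod (s d))^2 = p d" for d using p(1) by (simp add: s_def)
  have s: "summable (\<lambda>d. (cmod (s d))^2)" using p(2) by (simp add: sp)
  note l2 = block_vec_l2'[OF s]
  let ?K = "\<lambda>d. sesq (E (outer (hw d) (hw d))) a (e a) a (e a)"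
  have zero: "s d * cnj (s d) * ?K d = 0" if "d \<noteq> a + D" for d
  proof (cases "s d = 0")
    case False
    show ?thesis
    \<comment> \<open>\<open>unique\<close> concerns natural shifts only, so blocks below
      \<open>a\<close> are left to \<open>no_raising\<close>.\<close>
    proof (cases "d < a")
      case True
      then show ?thesis using no_raising[OF s out coh(1) coh(2) False True] by simp
    next
      case ge: False
      then have "d - a \<noteq> D" using that by linarith
      then obtain b where b: "q b \<noteq> 0" "p (b + (d - a)) = 0" using unique by blast
      have "?K d = 0"
        by (rule no_partial_shift[OF s out, of b]) (use b ge False in \<open>auto simp: s_def t_def\<close>)
      then show ?thesis by simp
    qed
  qed simp
  have "(\<lambda>d. cnj (s d) * sesq (E (outer (block_vec e s) (hw d))) a (e a) a (e a))
      sums sesq (E (outer (block_vec e s) (block_vec e s))) a (e a) a (e a)"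
    by (rule sesq_sums[OF l2 s])
  also have "(\<lambda>d. cnj (s d) * sesq (E (outer (block_vec e s) (hw d))) a (e a) a (e a))
      = (\<lambda>d. if d = a + D then s d * cnj (s d) * ?K d else 0)"
  proof
    fix d
    have "sesq (E (outer (block_vec e s) (hw d))) a (e a) a (e a) = cnj (sesq (E (outer (hw d) (block_vec e s))) a (e a) a (e a))"
      by (rule pair_cauchy(2)[OF hw_l2 l2])
    also have "\<dots> = s d * cnj (?K d)"
      using hw_block_vec_sesq[OF s, of d a a d] by simp
    also have "cnj (?K d) = ?K d" by (rule pair_cauchy(2)[OF hw_l2 hw_l2, symmetric])
    finally show "cnj (s d) * sesq (E (outer (block_vec e s) (hw d))) a (e a) a (e a) = (if d = a + D then s d * cnj (s d) * ?K d else 0)"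
      using zero[of d] by (simp add: mult_ac)
  qed
  also have "sesq (E (outer (block_vec e s) (block_vec e s))) a (e a) a (e a) = of_real (lam * q a)"
  proof -
    have "t a * cnj (t a) = of_real (q a)" using q by (simp add: t_def flip: of_real_mult)
    then show ?thesis unfolding out sesq_outer block_vec_inner e_inner by simp
  qed
  finally have "s (a + D) * cnj (s (a + D)) * ?K (a + D) = of_real (lam * q a)"
    by (rule sums_unique2[OF sums_single[of "a + D" "\<lambda>d. s d * cnj (s d) * ?K d"]])
  then have "of_real (p (a + D)) * ?K (a + D) = of_real (lam * q a)"
    by (simp only: complex_norm_square[symmetric] sp)
  then have "p (a + D) * Re (?K (a + D)) = lam * q a"
    by (metis Re_complex_of_real times_complex.sel(1) Im_complex_of_real mult_zero_left diff_zero)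
  moreover have "p (a + D) * Re (?K (a + D)) \<le> p (a + D) * 1"
    using p(1) transition_le_one by (intro mult_left_mono) auto
  ultimately show ?thesis by simp
qed

end

section \<open>The optimal probability as an infimum of ratios\<close>

theorem theorem22:
  fixes nx ny nz J :: real and e :: "nat \<Rightarrow> nat \<Rightarrow> complex" and p q :: "nat \<Rightarrow> real"
  assumes unit: "nx^2 + ny^2 + nz^2 = 1"
    and e_norm: "\<forall>d. (\<Sum>k\<le>d. (cmod (e d k))^2) = 1"
    and e_eig: "\<forall>d. \<forall>k\<le>d. (\<Sum>l\<le>d. nJ nx ny nz d k l * e d l) = complex_of_real (real d / 2) * e d k"
    and p_nonneg: "\<forall>d. 0 \<le> p d" and p_sum: "p sums 1"
    and q_nonneg: "\<forall>d. 0 \<le> q d" and q_sum: "q sums 1"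
    and J: "J \<in> halfints" "jSpec q \<subseteq> (\<lambda>j. j - J) ` jSpec p"
    and J_unique: "\<forall>J' \<in> halfints. jSpec q \<subseteq> (\<lambda>j. j - J') ` jSpec p \<longrightarrow> J' = J"
  shows "is_max_prob (hstate e p) (hstate e q)
           (Inf {coef p j / coef q (j - J) | j. j \<in> halfints \<and> j - J \<in> halfints \<and> coef q (j - J) > 0})"
proof -
  obtain \<alpha> \<beta> where coh: "\<alpha> \<noteq> 0 \<or> \<beta> \<noteq> 0" "\<And>d. \<exists>c. cmod c = 1 \<and> (\<forall>k\<le>d. e d k = c * coherent \<alpha> \<beta> d k)"
    using highest_weight_coherent[OF unit e_norm e_eig] by blast
  have coef: "coef f (real d / 2) = f d" for f :: "nat \<Rightarrow> real" and d
    by (simp add: coef_def)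
  obtain D where D: "J = real D / 2" using J(1) by (auto simp: halfints_def)
  have jSpec: "jSpec f = (\<lambda>d. real d / 2) ` {d. f d \<noteq> 0}" for f
  proof (intro equalityI subsetI)
    fix x assume "x \<in> jSpec f"
    then obtain d where d: "x = real d / 2" "coef f x \<noteq> 0" by (auto simp only: jSpec_def halfints_def mem_Collect_eq)
    then have "f d \<noteq> 0" by (simp only: coef not_False_eq_True)
    then show "x \<in> (\<lambda>d. real d / 2) ` {d. f d \<noteq> 0}" unfolding d(1) by (intro imageI CollectI)
  next
    fix x assume "x \<in> (\<lambda>d. real d / 2) ` {d. f d \<noteq> 0}"
    then obtain d where d: "x = real d / 2" "f d \<noteq> 0" by blast
    then have "coef f x \<noteq> 0" by (simp only: coef not_False_eq_True)
    then show "x \<in> jSpec f" using d(1) by (auto simp only: jSpec_def halfints_def mem_Collect_eq)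
  qed
  \<comment> \<open>With doubled spins \<open>J\<close> becomes the natural number \<open>D\<close>,
    and inclusion of spectra becomes a condition on supports.\<close>
  have shift: "jSpec q \<subseteq> (\<lambda>j. j - real M / 2) ` jSpec p \<longleftrightarrow> (\<forall>b. q b \<noteq> 0 \<longrightarrow> p (b + M) \<noteq> 0)" for M
  proof
    assume sub: "jSpec q \<subseteq> (\<lambda>j. j - real M / 2) ` jSpec p"
    show "\<forall>b. q b \<noteq> 0 \<longrightarrow> p (b + M) \<noteq> 0"
    proof (intro allI impI)
      fix b assume "q b \<noteq> 0"
      then have "real b / 2 \<in> (\<lambda>j. j - real M / 2) ` jSpec p" using sub by (auto simp: jSpec)
      then obtain d where "p d \<noteq> 0" "real b / 2 = real d / 2 - real M / 2" by (auto simp: jSpec)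
      moreover from this(2) have "d = b + M" by linarith
      ultimately show "p (b + M) \<noteq> 0" by simp
    qed
  next
    assume "\<forall>b. q b \<noteq> 0 \<longrightarrow> p (b + M) \<noteq> 0"
    then show "jSpec q \<subseteq> (\<lambda>j. j - real M / 2) ` jSpec p"
      by (force simp: jSpec add_divide_distrib image_iff)
  qed
  have supp: "p (b + D) \<noteq> 0" if "q b \<noteq> 0" for b
    using J(2) that unfolding D shift by blast
  have unique: "\<exists>b. q b \<noteq> 0 \<and> p (b + M) = 0" if "M \<noteq> D" for M
  proof (rule ccontr)
    assume "\<not> ?thesis"
    then have "jSpec q \<subseteq> (\<lambda>j. j - real M / 2) ` jSpec p" unfolding shift by blast
    moreover have "real M / 2 \<in> halfints" by (auto simp: halfints_def)
    ultimately have "real M / 2 = J" using J_unique by blast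
    then show False using that by (simp add: D)
  qed
  define R where "R = {p (b + D) / q b | b. q b > 0}"
  have R: "{coef p j / coef q (j - J) | j. j \<in> halfints \<and> j - J \<in> halfints \<and> coef q (j - J) > 0} = R"
  proof (intro set_eqI iffI)
    fix r assume "r \<in> {coef p j / coef q (j - J) | j. j \<in> halfints \<and> j - J \<in> halfints \<and> coef q (j - J) > 0}"
    then obtain j where j: "r = coef p j / coef q (j - J)" "j - J \<in> halfints" "coef q (j - J) > 0" by blast
    then obtain b where b: "j - J = real b / 2" by (auto simp: halfints_def)
    then have "j = real (b + D) / 2" by (simp add: D add_divide_distrib)
    then have "coef p j = p (b + D)" by (simp only: coef)
    moreover have "coef q (j - J) = q b" unfolding b by (rule coef)
    ultimately show "r \<in> R" using j unfolding R_def by auto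
  next
    fix r assume "r \<in> R"
    then obtain b where b: "r = p (b + D) / q b" "q b > 0" by (auto simp: R_def)
    have half: "real n / 2 \<in> halfints" for n unfolding halfints_def by blast
    have jb: "real (b + D) / 2 - J = real b / 2" by (simp add: D add_divide_distrib)
    show "r \<in> {coef p j / coef q (j - J) | j. j \<in> halfints \<and> j - J \<in> halfints \<and> coef q (j - J) > 0}"
      by (rule CollectI, rule exI[of _ "real (b + D) / 2"], unfold jb coef) (use b half in blast)
  qed
  \<comment> \<open>Total mass 1 makes \<open>R\<close> nonempty, without which \<open>Inf R\<close>
    would have no meaning as a greatest lower bound.\<close>
  have "\<exists>b. q b \<noteq> 0"
  proof (rule ccontr)
    assume "\<not> ?thesis"
    then have "q = (\<lambda>_. 0)" by auto
    then show False using q_sum sums_unique2[OF sums_zero] by fastforce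
  qed
  then have ne: "R \<noteq> {}" using q_nonneg unfolding R_def by (auto simp: less_le)
  have R0: "0 \<le> r" if "r \<in> R" for r
    using that p_nonneg by (auto simp: R_def)
  have lower: "Inf R * q d \<le> p (d + D)" for d
  proof (cases "q d = 0")
    case False
    then have qd: "q d > 0" using q_nonneg by (simp add: less_le)
    then have "Inf R \<le> p (d + D) / q d"
      using R0 by (intro cInf_lower bdd_belowI[of _ 0]) (auto simp: R_def)
    then show ?thesis using qd by (simp add: le_divide_eq)
  qed (use p_nonneg in simp)
  \<comment> \<open>Only the lower bound property of \<open>Inf R\<close> is used, so no ratio has
    to attain it.\<close>
  have "achievable (hstate e p) (hstate e q) (Inf R)"
    using p_nonneg q_nonneg R0 ne lower
    by (intro achievable_lower[OF e_norm coh(2)]) (auto intro: cInf_greatest)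
  moreover have "lam \<le> Inf R" if "achievable (hstate e p) (hstate e q) lam" for lam
  proof -
    obtain E where E: "su2_invariant_operation E"
      "E (outer (hstate e p) (hstate e p)) = (\<lambda>x y. of_real lam * outer (hstate e q) (hstate e q) x y)"
      using \<open>achievable _ _ lam\<close> unfolding achievable_def by blast
    interpret invariant_on_axis E nx ny nz e
      using E(1) e_norm e_eig by unfold_locales
    have "lam * q b \<le> p (b + D)" if "q b > 0" for b
      using that by (intro achieved_le[OF p_nonneg sums_summable[OF p_sum] q_nonneg E(2) coh unique]) auto
    then show ?thesis using ne by (intro cInf_greatest) (auto simp: R_def le_divide_eq)
  qed
  ultimately show ?thesis unfolding R is_max_prob_def by blast
qed

end
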